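(* Let $S$ be a strictly positive symmetric operator on a complex Hilbert space $\mathcal{H}$ and let $A=iS$. Let $S_F$ and $S_K$ denote the Friedrichs and the Kreĭn–von Neumann extension of $S$. Then the dissipative extensions of $A$ are precisely the operators $A_{\mathcal{V},\mathcal{L}}$ given by $$\mathcal{D}(A_{\mathcal{V},\mathcal{L}})=\mathcal{D}(A)\dot{+}\mathcal{V},\qquad A_{\mathcal{V},\mathcal{L}}(f+v)= iSf+iS_F\mathcal{L}v\quad (f\in\mathcal{D}(A),\ v\in\mathcal{V}),$$ where $\mathcal{V}\subset\mathcal{D}(S_K^{1/2})$ is a subspace with $\mathcal{V}\cap\mathcal{D}(A)=\{0\}$ and $\mathcal{L}:\mathcal{V}\to\mathcal{D}(S_F)$ is a linear operator, which satisfy $$\mathrm{Re}\langle v,S_F\mathcal{L}v\rangle\geq\frac{1}{4}\big\|S_K^{1/2}(\mathcal{L}v+v)\big\|^2\qquad\text{for every } v\in\mathcal{V}.$$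
   Context: Inner products are linear in the second component. A densely defined linear operator $T$ is dissipative if $\mathrm{Im}\langle f,Tf\rangle\geq0$ for all $f\in\mathcal{D}(T)$. A symmetric (in particular densely defined) operator $S$ is strictly positive if there is $\varepsilon>0$ with $\langle f,Sf\rangle\geq\varepsilon\|f\|^2$ for all $f\in\mathcal{D}(S)$. $S_F$ denotes the Friedrichs extension of $S$ (selfadjoint and strictly positive). The Kreĭn–von Neumann extension $S_K$ of $S$ is the nonnegative selfadjoint operator defined by $\mathcal{D}(S_K)=\mathcal{D}(\overline{S})\dot{+}\ker(S^* )$, $S_K=S^*\upharpoonright_{\mathcal{D}(S_K)}$, where $\overline{S}$ is the closure of $S$. It is well known that $\mathcal{D}(S_K^{1/2})=\mathcal{D}(S_F^{1/2})\dot{+}\ker(S^* )$ and that $\|S_K^{1/2}(f+v)\|^2=\|S_F^{1/2}f\|^2$ for $f\in\mathcal{D}(S_F^{1/2})$, $v\in\ker(S^* )$. $\dot{+}$ denotes an algebraic direct sum. *)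

theory Defs
  imports "HOL-Analysis.Analysis"
begin

section \<open>Complex Hilbert spaces\<close>

class complex_vector = real_vector +
  fixes scaleC :: "complex \<Rightarrow> 'a \<Rightarrow> 'a"  (infixr \<open>*\<^sub>C\<close> 75)
  assumes scaleC_add_right: "c *\<^sub>C (x + y) = c *\<^sub>C x + c *\<^sub>C y"
    and scaleC_add_left: "(c + d) *\<^sub>C x = c *\<^sub>C x + d *\<^sub>C x"
    and scaleC_scaleC: "c *\<^sub>C d *\<^sub>C x = (c * d) *\<^sub>C x"
    and scaleC_one: "1 *\<^sub>C x = x"
    and scaleR_scaleC: "r *\<^sub>R x = complex_of_real r *\<^sub>C x"

global_interpretation complex_vector: vector_space "scaleC :: complex \<Rightarrow> 'a \<Rightarrow> 'a::complex_vector"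
  by unfold_locales (rule scaleC_add_right scaleC_add_left scaleC_scaleC scaleC_one)+

text \<open>
  The inner product is linear in the second component. Its real part is the inner product
  of the underlying real Hilbert space; since \<open>cinner x x\<close> is real by conjugate symmetry,
  positive definiteness and \<open>(norm x)\<^sup>2 = cinner x x\<close> are inherited from \<^class>\<open>real_inner\<close>.
\<close>

class chilbert_space = complex_vector + banach + real_inner +
  fixes cinner :: "'a \<Rightarrow> 'a \<Rightarrow> complex"
  assumes cinner_commute: "cinner x y = cnj (cinner y x)"
    and cinner_add_right: "cinner x (y + z) = cinner x y + cinner x z"
    and cinner_scaleC_right: "cinner x (c *\<^sub>C y) = c * cinner x y"
    and Re_cinner: "Re (cinner x y) = x \<bullet> y"

definition clinear_on :: "'a::complex_vector set \<Rightarrow> ('a \<Rightarrow> 'a) \<Rightarrow> bool" where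
  "clinear_on V L \<longleftrightarrow>
     (\<forall>x\<in>V. \<forall>y\<in>V. L (x + y) = L x + L y) \<and> (\<forall>c. \<forall>x\<in>V. L (c *\<^sub>C x) = c *\<^sub>C L x)"


section \<open>Unbounded operators\<close>

text \<open>
  An operator with a domain is represented by its graph, so that equality of operators includes
  equality of domains, \<open>T \<subseteq> T'\<close> says that \<open>T'\<close> extends \<open>T\<close>, \<^term>\<open>Domain T\<close> is the
  domain, \<^term>\<open>closure T\<close> (in the product topology) is the graph of the operator closure of a
  closable operator, and \<^term>\<open>T O T\<close> is the square of \<open>T\<close> on its natural domain.
\<close>

type_synonym 'a operator = "('a \<times> 'a) set"

definition op_app :: "'a operator \<Rightarrow> 'a \<Rightarrow> 'a" where
  "op_app T f = (THE g. (f, g) \<in> T)"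

definition linear_op :: "'a::complex_vector operator \<Rightarrow> bool" where
  "linear_op T \<longleftrightarrow>
     single_valued T \<and> complex_vector.subspace (Domain T) \<and> clinear_on (Domain T) (op_app T)"

definition densely_defined :: "'a::chilbert_space operator \<Rightarrow> bool" where
  "densely_defined T \<longleftrightarrow> linear_op T \<and> closure (Domain T) = UNIV"

definition op_scaleC :: "complex \<Rightarrow> 'a::complex_vector operator \<Rightarrow> 'a operator" where
  "op_scaleC c T = {(f, c *\<^sub>C g) | f g. (f, g) \<in> T}"

definition op_ker :: "'a::zero operator \<Rightarrow> 'a set" where
  "op_ker T = {f. (f, 0) \<in> T}"

definition op_adj :: "'a::chilbert_space operator \<Rightarrow> 'a operator" where
  "op_adj T = {(g, h). \<forall>f\<in>Domain T. cinner g (op_app T f) = cinner h f}"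

definition dissipative :: "'a::chilbert_space operator \<Rightarrow> bool" where
  "dissipative T \<longleftrightarrow>
     densely_defined T \<and> (\<forall>f\<in>Domain T. 0 \<le> Im (cinner f (op_app T f)))"

definition symmetric_op :: "'a::chilbert_space operator \<Rightarrow> bool" where
  "symmetric_op S \<longleftrightarrow>
     densely_defined S \<and>
     (\<forall>f\<in>Domain S. \<forall>g\<in>Domain S. cinner f (op_app S g) = cinner (op_app S f) g)"

definition selfadjoint :: "'a::chilbert_space operator \<Rightarrow> bool" where
  "selfadjoint T \<longleftrightarrow> densely_defined T \<and> op_adj T = T"

text \<open>
  For symmetric operators \<open>\<langle>f, S f\<rangle>\<close> is real, so that taking the real part in the
  following definitions loses nothing.
\<close>

definition nonnegative :: "'a::chilbert_space operator \<Rightarrow> bool" where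
  "nonnegative T \<longleftrightarrow>
     symmetric_op T \<and> (\<forall>f\<in>Domain T. 0 \<le> Re (cinner f (op_app T f)))"

definition strictly_positive :: "'a::chilbert_space operator \<Rightarrow> bool" where
  "strictly_positive S \<longleftrightarrow>
     symmetric_op S \<and>
     (\<exists>\<epsilon>>0. \<forall>f\<in>Domain S. \<epsilon> * (norm f)\<^sup>2 \<le> Re (cinner f (op_app S f)))"

text \<open>
  The nonnegative selfadjoint square root of a nonnegative selfadjoint operator exists and
  is unique, so the choice is determined whenever \<open>T\<close> is nonnegative and selfadjoint.
\<close>

definition op_sqrt :: "'a::chilbert_space operator \<Rightarrow> 'a operator" where
  "op_sqrt T = (SOME B. selfadjoint B \<and> nonnegative B \<and> B O B = T)"


section \<open>The Friedrichs and the Krein--von Neumann extension\<close>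

text \<open>
  For strictly positive \<open>S\<close>, this is the domain of the closure of the form
  \<open>f \<mapsto> \<langle>f, S f\<rangle>\<close>: all limits of sequences in the domain of \<open>S\<close> that are Cauchy
  with respect to the form.
\<close>

definition form_closure_domain :: "'a::chilbert_space operator \<Rightarrow> 'a set" where
  "form_closure_domain S =
     {f. \<exists>u :: nat \<Rightarrow> 'a. (\<forall>n. u n \<in> Domain S) \<and> u \<longlonglongrightarrow> f \<and>
         (\<forall>e>0. \<exists>N. \<forall>m\<ge>N. \<forall>n\<ge>N. Re (cinner (u m - u n) (op_app S (u m - u n))) < e)}"

text \<open>The Friedrichs extension is the restriction of the adjoint to the closed form domain.\<close>

definition friedrichs_ext :: "'a::chilbert_space operator \<Rightarrow> 'a operator" where
  "friedrichs_ext S = {(f, g) \<in> op_adj S. f \<in> form_closure_domain S}"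

definition krein_ext :: "'a::chilbert_space operator \<Rightarrow> 'a operator" where
  "krein_ext S =
     {(h, k) \<in> op_adj S. \<exists>f\<in>Domain (closure S). \<exists>v\<in>op_ker (op_adj S). h = f + v}"


section \<open>The extensions $A_{\mathcal{V},\mathcal{L}}$ of $A = iS$\<close>

definition ext_VL :: "'a::chilbert_space operator \<Rightarrow> 'a set \<Rightarrow> ('a \<Rightarrow> 'a) \<Rightarrow> 'a operator" where
  "ext_VL S V L =
     {(f + v, \<i> *\<^sub>C op_app S f + \<i> *\<^sub>C op_app (friedrichs_ext S) (L v)) | f v.
        f \<in> Domain (op_scaleC \<i> S) \<and> v \<in> V}"

end

theory Submission
  imports Defs
begin

text \<open>
  By surjectivity of \<open>S\<^sub>F\<close>, every extension of \<open>i S\<close> has the form \<open>f + v \<mapsto> i S f + i S\<^sub>F (L v)\<close> on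
  an algebraic complement. Its dissipativity at \<open>f + v\<close> reads
  \<open>\<langle>f, S f\<rangle> + Re \<langle>L v + v, S f\<rangle> + Re \<langle>v, S\<^sub>F (L v)\<rangle> \<ge> 0\<close>. Scaling \<open>f\<close> and taking the discriminant,
  this holds for all \<open>f\<close> iff \<open>(Re \<langle>L v + v, S f\<rangle>)\<^sup>2 \<le> 4 Re \<langle>v, S\<^sub>F (L v)\<rangle> \<langle>f, S f\<rangle>\<close> for all \<open>f\<close>,
  which by the theorem of Ando and Nishio says that \<open>L v + v\<close> lies in the domain of \<open>S\<^sub>K\<^sup>1\<^sup>/\<^sup>2\<close> and
  \<open>\<parallel>S\<^sub>K\<^sup>1\<^sup>/\<^sup>2 (L v + v)\<parallel>\<^sup>2 \<le> 4 Re \<langle>v, S\<^sub>F (L v)\<rangle>\<close>. The square root exists because \<open>S\<^sub>K\<close> is the pseudoinverse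
  of a bounded nonnegative operator. Domains and graphs being complex subspaces, all these
  conditions are stated with the real inner product.
\<close>

text \<open>Two features of the statement shape the work. \<open>op_sqrt\<close> is a choice, so
  nothing can be said about it before one nonnegative selfadjoint root of \<open>krein_ext S\<close>
  is exhibited. That operator is unbounded and may have a large kernel; the root is therefore taken
  on the bounded side and carried back by pseudoinversion, which commutes with squaring. Moreover
  \<open>S\<close> is not assumed closed, so bounds are tested on its graph and extended to
  \<open>closure S\<close> by continuity.

  Form domains are not completed. A single minimising-sequence version of the Riesz theorem yields
  orthogonal projections, the surjectivity of \<open>1 + t B^2\<close> and of
  \<open>friedrichs_ext S\<close>, and the value of the root in the converse of Ando-Nishio.

  The discriminant argument controls \<open>L v + v\<close>, whereas the theorem asks for
  \<open>V\<close> inside the domain of the root. The two agree because the domain of the Friedrichs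
  extension, which contains \<open>L v\<close>, is contained in that of the root. The factor 1/4 is
  the 4 of the discriminant.\<close>

section \<open>Discriminants of real quadratics\<close>

lemma discriminant_le_if_nonneg:
  fixes a b c :: real
  assumes "0 \<le> a" and pos: "\<And>t. 0 \<le> a * t\<^sup>2 + b * t + c"
  shows "b\<^sup>2 \<le> 4 * a * c"
proof (cases "a = 0")
  case True
  have "b = 0"
  proof (rule ccontr)
    assume "b \<noteq> 0"
    \<comment> \<open>For \<open>a = 0\<close> the polynomial is linear and takes the value
      \<open>- 1\<close> at this point.\<close>
    with pos[of "- (c + 1) / b"] True show False by simp
  qed
  with True show ?thesis by simp
next
  case False
  with \<open>0 \<le> a\<close> have "0 < a" by simp
  have "a * (- b / (2 * a))\<^sup>2 + b * (- b / (2 * a)) + c = (4 * a * c - b\<^sup>2) / (4 * a)"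
    using \<open>0 < a\<close> by (simp add: field_simps power2_eq_square)
  with pos[of "- b / (2 * a)"] \<open>0 < a\<close> show ?thesis
    by (simp add: zero_le_divide_iff)
qed

text \<open>AM-GM: \<open>c * q\<close> is at most \<open>((c + q) / 2)^2\<close>. This leads back
  from a discriminant bound to nonnegativity of the quadratic \<open>q * t^2 + 2 * l * t + c\<close>
  at \<open>t = 1\<close>.\<close>

lemma two_mul_le_add_if_square_le:
  fixes l c q :: real
  assumes "l\<^sup>2 \<le> c * q" "0 \<le> c" "0 \<le> q"
  shows "2 * \<bar>l\<bar> \<le> c + q"
proof -
  have "(2 * \<bar>l\<bar>)\<^sup>2 \<le> 4 * (c * q)" using assms by (simp add: power_mult_distrib)
  also have "\<dots> \<le> (c + q)\<^sup>2" using zero_le_power2[of "c - q"]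
    by (simp add: power2_sum power2_diff)
  finally show ?thesis by (rule power2_le_imp_le) (use assms in simp)
qed

section \<open>Nonnegative quadratic forms and the projection theorem\<close>

text \<open>Semidefinite and without completeness, so as to cover the form of \<open>S\<close>, the
  graph form of a selfadjoint operator, the form of a bounded nonnegative operator and the inner
  product on a subspace.\<close>

locale nonneg_form =
  fixes D :: "'a::real_vector set" and q :: "'a \<Rightarrow> 'a \<Rightarrow> real"
  assumes subspace: "subspace D"
    and sym: "\<lbrakk>f \<in> D; g \<in> D\<rbrakk> \<Longrightarrow> q f g = q g f"
    and add: "\<lbrakk>f \<in> D; g \<in> D; h \<in> D\<rbrakk> \<Longrightarrow> q (f + g) h = q f h + q g h"
    and scale: "\<lbrakk>f \<in> D; h \<in> D\<rbrakk> \<Longrightarrow> q (c *\<^sub>R f) h = c * q f h"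
    and nonneg: "f \<in> D \<Longrightarrow> 0 \<le> q f f"
begin

lemmas mem = subspace_add[OF subspace] subspace_scale[OF subspace] subspace_diff[OF subspace]

lemma square_add_scale:
  assumes "f \<in> D" "g \<in> D"
  shows "q (f + t *\<^sub>R g) (f + t *\<^sub>R g) = q g g * t\<^sup>2 + 2 * t * q f g + q f f"
  using assms sym[of g f] sym[of f "f + t *\<^sub>R g"] sym[of g "f + t *\<^sub>R g"]
  by (simp add: add scale mem algebra_simps power2_eq_square)

lemma Cauchy_Schwarz:
  assumes "f \<in> D" "g \<in> D"
  shows "(q f g)\<^sup>2 \<le> q f f * q g g"
proof -
  have "(2 * q f g)\<^sup>2 \<le> 4 * q g g * q f f"
  proof (rule discriminant_le_if_nonneg)
    fix t :: real
    show "0 \<le> q g g * t\<^sup>2 + 2 * q f g * t + q f f"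
      using nonneg[of "f + t *\<^sub>R g"] assms square_add_scale[of f g t]
      by (simp add: mem mult_ac)
  qed (use assms nonneg in auto)
  then show ?thesis by (simp add: power_mult_distrib mult_ac)
qed

text \<open>
  The Riesz representation in the (possibly incomplete) form space: the functional is represented
  by a Cauchy sequence that minimises \<open>f \<mapsto> q f f - 2 * l f\<close>.
\<close>

lemma Riesz_sequence:
  fixes l :: "'a \<Rightarrow> real"
  assumes l_add: "\<And>f g. \<lbrakk>f \<in> D; g \<in> D\<rbrakk> \<Longrightarrow> l (f + g) = l f + l g"
    and l_scale: "\<And>c f. f \<in> D \<Longrightarrow> l (c *\<^sub>R f) = c * l f"
    and l_bound: "\<And>f. f \<in> D \<Longrightarrow> (l f)\<^sup>2 \<le> C * q f f" and "0 \<le> C"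
  shows "\<exists>u. (\<forall>n::nat. u n \<in> D) \<and>
    (\<forall>e>0. \<exists>N. \<forall>m\<ge>N. \<forall>n\<ge>N. q (u m - u n) (u m - u n) < e) \<and>
    (\<forall>g\<in>D. (\<lambda>n. q (u n) g) \<longlonglongrightarrow> l g)"
proof -
  define F where "F f = q f f - 2 * l f" for f
  define m where "m = Inf (F ` D)"
  have ne: "F ` D \<noteq> {}" using subspace_0[OF subspace] by auto
  have "- C \<le> F f" if "f \<in> D" for f
    using two_mul_le_add_if_square_le[OF l_bound[OF that] \<open>0 \<le> C\<close> nonneg[OF that]]
    by (simp add: F_def)
  then have bdd: "bdd_below (F ` D)" by (auto simp: bdd_below_def)
  have m_le: "m \<le> F f" if "f \<in> D" for f
    unfolding m_def using bdd that by (simp add: cINF_lower)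
  have "\<exists>f\<in>D. F f < m + inverse (real (Suc n))" for n
    using cInf_lessD[OF ne, of "m + inverse (real (Suc n))"] unfolding m_def by force
  then obtain u where uD: "\<And>n. u n \<in> D" and u: "\<And>n. F (u n) < m + inverse (real (Suc n))"
    using choice[of "\<lambda>n f. f \<in> D \<and> F f < m + inverse (real (Suc n))"] by blast
  have F_scale: "F (f + t *\<^sub>R g) = q g g * t\<^sup>2 + 2 * (q f g - l g) * t + F f"
    if "f \<in> D" "g \<in> D" for f g t
    using that by (simp add: F_def square_add_scale l_add l_scale mem algebra_simps)
  have close: "q (f - g) (f - g) \<le> 2 * d + 2 * e"
    if "f \<in> D" "g \<in> D" "F f \<le> m + d" "F g \<le> m + e" for f g d e
  proof -
    \<comment> \<open>Parallelogram argument: the mean of \<open>F f\<close> and \<open>F g\<close>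
      exceeds the value of \<open>F\<close> at the midpoint, which is at least \<open>m\<close>, by
      exactly a quarter of the form of \<open>f - g\<close>.\<close>
    have "F (g + (1/2) *\<^sub>R (f - g)) = q (f - g) (f - g) / 4 + (q g (f - g) - l (f - g)) + F g"
      using F_scale[of g "f - g" "1/2"] that by (simp add: mem field_simps power2_eq_square)
    moreover have "F f = q (f - g) (f - g) + 2 * (q g (f - g) - l (f - g)) + F g"
      using F_scale[of g "f - g" 1] that by (simp add: mem)
    moreover have "m \<le> F (g + (1/2) *\<^sub>R (f - g))" using that by (intro m_le) (simp add: mem)
    ultimately show ?thesis using that by (simp add: algebra_simps)
  qed
  show ?thesis
  proof (intro exI[of _ u] conjI allI ballI impI)
    show "u n \<in> D" for n by (rule uD)
  next
    fix e :: real assume "0 < e"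
    then obtain N where N: "inverse (real (Suc N)) < e / 4" using reals_Archimedean[of "e / 4"] by auto
    have "q (u i - u j) (u i - u j) < e" if "i \<ge> N" "j \<ge> N" for i j
    proof -
      have *: "inverse (real (Suc i)) \<le> inverse (real (Suc N))"
              "inverse (real (Suc j)) \<le> inverse (real (Suc N))" using that by (auto simp: field_simps)
      show ?thesis using close[OF uD uD less_imp_le[OF u] less_imp_le[OF u], of i j] * N by linarith
    qed
    then show "\<exists>N. \<forall>m\<ge>N. \<forall>n\<ge>N. q (u m - u n) (u m - u n) < e" by blast
  next
    fix g assume g: "g \<in> D"
    \<comment> \<open>As \<open>u n\<close> misses the infimum by less than
      \<open>1 / (n + 1)\<close>, the quadratic that describes \<open>F\<close> along the line from
      \<open>u n\<close> in direction \<open>g\<close> is almost minimal at 0. Its discriminant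
      bounds the linear coefficient, the defect \<open>q (u n) g - l g\<close>.\<close>
    have bound: "(q (u n) g - l g)\<^sup>2 \<le> q g g * inverse (real (Suc n))" for n
    proof -
      have "(2 * (q (u n) g - l g))\<^sup>2 \<le> 4 * q g g * inverse (real (Suc n))"
      proof (rule discriminant_le_if_nonneg)
        fix t :: real
        show "0 \<le> q g g * t\<^sup>2 + 2 * (q (u n) g - l g) * t + inverse (real (Suc n))"
          using m_le[of "u n + t *\<^sub>R g"] F_scale[OF uD g, of n t] u[of n] uD g
          by (simp add: mem)
      qed (rule nonneg[OF g])
      then show ?thesis unfolding power_mult_distrib by simp
    qed
    have "(\<lambda>n. (q (u n) g - l g)\<^sup>2) \<longlonglongrightarrow> 0"
    proof (rule real_tendsto_sandwich[where f = "\<lambda>_. 0"])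
      show "\<forall>\<^sub>F n in sequentially. (q (u n) g - l g)\<^sup>2 \<le> q g g * inverse (real (Suc n))"
        using bound by simp
      show "(\<lambda>n. q g g * inverse (real (Suc n))) \<longlonglongrightarrow> 0"
        by (rule tendsto_mult_right_zero[OF LIMSEQ_inverse_real_of_nat])
    qed auto
    then have "(\<lambda>n. q (u n) g - l g) \<longlonglongrightarrow> 0" by simp
    then show "(\<lambda>n. q (u n) g) \<longlonglongrightarrow> l g" by (simp add: LIM_zero_iff)
  qed
qed

end

lemma nonneg_form_inner: "subspace D \<Longrightarrow> nonneg_form D inner"
  by unfold_locales (auto simp: inner_add_left, simp add: inner_commute)

section \<open>Orthogonal projections and density\<close>

lemma Cauchy_if_norm_diff_square:
  fixes u :: "nat \<Rightarrow> 'a::real_normed_vector"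
  assumes "\<And>e. 0 < e \<Longrightarrow> \<exists>N. \<forall>m\<ge>N. \<forall>n\<ge>N. (norm (u m - u n))\<^sup>2 < e"
  shows "Cauchy u"
proof (rule CauchyI)
  fix e :: real assume "0 < e"
  then obtain N where "\<forall>m\<ge>N. \<forall>n\<ge>N. (norm (u m - u n))\<^sup>2 < e\<^sup>2" using assms[of "e\<^sup>2"] by auto
  then show "\<exists>M. \<forall>m\<ge>M. \<forall>n\<ge>M. norm (u m - u n) < e"
    using power2_less_imp_less[of _ e] \<open>0 < e\<close> less_imp_le by blast
qed

text \<open>The functional \<open>inner x\<close> on \<open>M\<close> is represented by a Cauchy
  sequence in \<open>M\<close>. Completeness and closedness turn it into a vector \<open>y\<close>
  of \<open>M\<close> with the same values on \<open>M\<close> as \<open>x\<close>.\<close>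

lemma orthogonal_projection_exists:
  fixes M :: "'a::{real_inner,banach} set"
  assumes "subspace M" "closed M"
  obtains y where "y \<in> M" "\<And>z. z \<in> M \<Longrightarrow> (x - y) \<bullet> z = 0"
proof -
  interpret nonneg_form M inner by (rule nonneg_form_inner[OF assms(1)])
  have "\<exists>u. (\<forall>n::nat. u n \<in> M) \<and>
      (\<forall>e>0. \<exists>N. \<forall>m\<ge>N. \<forall>n\<ge>N. (u m - u n) \<bullet> (u m - u n) < e) \<and>
      (\<forall>g\<in>M. (\<lambda>n. u n \<bullet> g) \<longlonglongrightarrow> x \<bullet> g)"
  proof (rule Riesz_sequence[of "inner x" "x \<bullet> x"])
    show "(x \<bullet> f)\<^sup>2 \<le> x \<bullet> x * (f \<bullet> f)" for f by (rule Cauchy_Schwarz_ineq)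
  qed (simp_all add: inner_add_right)
  then obtain u where u: "\<forall>n::nat. u n \<in> M"
    "\<forall>e>0. \<exists>N. \<forall>m\<ge>N. \<forall>n\<ge>N. (u m - u n) \<bullet> (u m - u n) < e"
    "\<forall>g\<in>M. (\<lambda>n. u n \<bullet> g) \<longlonglongrightarrow> x \<bullet> g"
    by blast
  have "Cauchy u"
    by (rule Cauchy_if_norm_diff_square) (simp add: power2_norm_eq_inner u(2))
  then obtain y where y: "u \<longlonglongrightarrow> y" using Cauchy_convergent_iff convergent_def by blast
  show ?thesis
  proof (rule that)
    show "y \<in> M" using closed_sequentially[OF \<open>closed M\<close> _ y] u(1) by blast
    fix z assume "z \<in> M"
    then have "x \<bullet> z = y \<bullet> z"
      using LIMSEQ_unique[OF u(3)[rule_format] tendsto_inner[OF y tendsto_const]] by blast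
    then show "(x - y) \<bullet> z = 0" by (simp add: inner_diff_left)
  qed
qed

lemma subspace_closure:
  fixes M :: "'a::real_normed_vector set"
  assumes "subspace M"
  shows "subspace (closure M)"
proof (rule subspaceI)
  show "0 \<in> closure M" using subspace_0[OF assms] closure_subset by blast
  fix x y assume "x \<in> closure M" "y \<in> closure M"
  then obtain u v where u: "\<forall>n. u n \<in> M" "u \<longlonglongrightarrow> x" and v: "\<forall>n. v n \<in> M" "v \<longlonglongrightarrow> y"
    unfolding closure_sequential by blast
  have "\<forall>n. u n + v n \<in> M" using u v by (simp add: subspace_add[OF assms])
  with tendsto_add[OF u(2) v(2)] show "x + y \<in> closure M" unfolding closure_sequential
    by (intro exI[of _ "\<lambda>n. u n + v n"]) auto
next
  fix c x assume "x \<in> closure M"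
  then obtain u where u: "\<forall>n. u n \<in> M" "u \<longlonglongrightarrow> x" unfolding closure_sequential by blast
  have "\<forall>n. c *\<^sub>R u n \<in> M" using u by (simp add: subspace_scale[OF assms])
  with tendsto_scaleR[OF tendsto_const u(2)] show "c *\<^sub>R x \<in> closure M"
    unfolding closure_sequential by (intro exI[of _ "\<lambda>n. c *\<^sub>R u n"]) auto
qed

text \<open>A closed subspace is its double orthogonal complement: \<open>x\<close> minus its
  projection is orthogonal to \<open>M\<close>, hence to \<open>x\<close>, hence to itself.\<close>

lemma mem_closed_subspace_if_orthogonal:
  fixes M :: "'a::{real_inner,banach} set"
  assumes "subspace M" "closed M" and "\<And>y. (\<And>z. z \<in> M \<Longrightarrow> y \<bullet> z = 0) \<Longrightarrow> x \<bullet> y = 0"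
  shows "x \<in> M"
proof -
  obtain y where y: "y \<in> M" "\<And>z. z \<in> M \<Longrightarrow> (x - y) \<bullet> z = 0"
    using orthogonal_projection_exists[OF assms(1,2)] by metis
  have "(x - y) \<bullet> (x - y) = 0"
    using assms(3)[OF y(2)] y(2)[OF y(1)] by (simp add: inner_diff_right inner_commute)
  with y show ?thesis by simp
qed

lemma dense_iff_orthogonal:
  fixes M :: "'a::{real_inner,banach} set"
  assumes "subspace M"
  shows "closure M = UNIV \<longleftrightarrow> (\<forall>y. (\<forall>z\<in>M. y \<bullet> z = 0) \<longrightarrow> y = 0)"
proof
  assume dense: "closure M = UNIV"
  show "\<forall>y. (\<forall>z\<in>M. y \<bullet> z = 0) \<longrightarrow> y = 0"
  proof (intro allI impI)
    fix y assume y: "\<forall>z\<in>M. y \<bullet> z = 0"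
    have "closed {z. y \<bullet> z = 0}" by (intro closed_Collect_eq continuous_intros)
    then have "closure M \<subseteq> {z. y \<bullet> z = 0}" using y by (intro closure_minimal) auto
    with dense have "y \<bullet> y = 0" by blast
    then show "y = 0" by simp
  qed
next
  assume orth: "\<forall>y. (\<forall>z\<in>M. y \<bullet> z = 0) \<longrightarrow> y = 0"
  have "x \<in> closure M" for x
  proof (rule mem_closed_subspace_if_orthogonal)
    show "subspace (closure M)" using assms by (rule subspace_closure)
    show "closed (closure M)" by simp
    fix y assume "\<And>z. z \<in> closure M \<Longrightarrow> y \<bullet> z = 0"
    with orth closure_subset have "y = 0" by blast
    then show "x \<bullet> y = 0" by simp
  qed
  then show "closure M = UNIV" by blast
qed

section \<open>Complex Hilbert spaces and linear operators as graphs\<close>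

lemma cinner_scaleC_left: "cinner (c *\<^sub>C x) y = cnj c * cinner x y"
  using cinner_commute[of "c *\<^sub>C x" y] cinner_commute[of x y] by (simp add: cinner_scaleC_right)

lemma inner_scaleC_left: "(c *\<^sub>C x) \<bullet> y = x \<bullet> (cnj c *\<^sub>C (y::'a::chilbert_space))"
  by (simp add: Re_cinner[symmetric] cinner_scaleC_left cinner_scaleC_right)

lemma Im_cinner: "Im (cinner x y) = - (x \<bullet> (\<i> *\<^sub>C y))"
  by (simp add: Re_cinner[symmetric] cinner_scaleC_right)

lemma Im_cinner_scaleC_ii: "Im (cinner x (\<i> *\<^sub>C y)) = x \<bullet> y"
  by (simp add: Re_cinner[symmetric] cinner_scaleC_right)

text \<open>The norm belongs to the real structure, so homogeneity under complex scalars has to be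
  derived, by moving \<open>c\<close> across the inner product as \<open>cnj c\<close>.\<close>

lemma norm_scaleC: "norm (c *\<^sub>C (x::'a::chilbert_space)) = cmod c * norm x"
proof -
  have "(c *\<^sub>C x) \<bullet> (c *\<^sub>C x) = (complex_of_real ((cmod c)\<^sup>2) *\<^sub>C x) \<bullet> x"
    by (simp add: inner_scaleC_left scaleC_scaleC complex_norm_square mult.commute
          inner_commute del: of_real_power)
  also have "\<dots> = (cmod c)\<^sup>2 * (x \<bullet> x)" by (metis scaleR_scaleC inner_scaleR_left)
  finally have "(norm (c *\<^sub>C x))\<^sup>2 = (cmod c * norm x)\<^sup>2"
    by (simp only: power2_norm_eq_inner power_mult_distrib)
  then show ?thesis by simp
qed

lemma tendsto_scaleC:
  fixes x :: "'a::chilbert_space"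
  assumes "(u \<longlongrightarrow> x) F"
  shows "((\<lambda>n. c *\<^sub>C u n) \<longlongrightarrow> c *\<^sub>C x) F"
proof -
  have "bounded_linear (\<lambda>x::'a. c *\<^sub>C x)"
    by (rule bounded_linear_intro[of _ "cmod c"])
       (simp_all add: scaleC_add_right scaleR_scaleC scaleC_scaleC norm_scaleC mult.commute)
  from bounded_linear.tendsto[OF this assms] show ?thesis .
qed

lemma subspace_if_complex_subspace:
  "complex_vector.subspace M \<Longrightarrow> subspace M"
  unfolding complex_vector.subspace_def subspace_def by (simp add: scaleR_scaleC)

lemma op_app_eq: "single_valued T \<Longrightarrow> (f, g) \<in> T \<Longrightarrow> op_app T f = g"
  unfolding op_app_def by (rule the_equality) (auto dest: single_valuedD)

text \<open>Adjoints, pseudoinverses and extensions are given as graphs, so linearity is best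
  checked on pairs rather than through the description operator in \<open>op_app\<close>.\<close>

lemma linear_op_iff:
  "linear_op T \<longleftrightarrow> single_valued T \<and> (0, 0) \<in> T \<and>
     (\<forall>f g f' g'. (f, g) \<in> T \<longrightarrow> (f', g') \<in> T \<longrightarrow> (f + f', g + g') \<in> T) \<and>
     (\<forall>c f g. (f, g) \<in> T \<longrightarrow> (c *\<^sub>C f, c *\<^sub>C g) \<in> T)"
  (is "_ \<longleftrightarrow> ?R")
proof
  assume T: "linear_op T"
  then have sv: "single_valued T" by (simp add: linear_op_def)
  have mem: "(f, op_app T f) \<in> T" if "f \<in> Domain T" for f
    using that op_app_eq[OF sv] by auto
  have sub: "complex_vector.subspace (Domain T)" and lin: "clinear_on (Domain T) (op_app T)"
    using T by (auto simp: linear_op_def)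
  have 0: "0 \<in> Domain T" using sub by (rule complex_vector.subspace_0)
  have "op_app T (0 *\<^sub>C 0) = 0 *\<^sub>C op_app T 0" using lin 0 unfolding clinear_on_def by blast
  with mem[OF 0] have "(0, 0) \<in> T" by simp
  moreover have "(f + f', g + g') \<in> T" if "(f, g) \<in> T" "(f', g') \<in> T" for f g f' g'
  proof -
    have D: "f \<in> Domain T" "f' \<in> Domain T" using that by auto
    have "op_app T (f + f') = g + g'"
      using lin D op_app_eq[OF sv] that unfolding clinear_on_def by metis
    then show ?thesis using mem[OF complex_vector.subspace_add[OF sub D]] by simp
  qed
  moreover have "(c *\<^sub>C f, c *\<^sub>C g) \<in> T" if "(f, g) \<in> T" for c f g
  proof -
    have D: "f \<in> Domain T" using that by auto
    have "op_app T (c *\<^sub>C f) = c *\<^sub>C g"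
      using lin D op_app_eq[OF sv] that unfolding clinear_on_def by metis
    then show ?thesis using mem[OF complex_vector.subspace_scale[OF sub D, of c]] by simp
  qed
  ultimately show ?R using sv by blast
next
  assume T: ?R
  then have sv: "single_valued T" by blast
  have "complex_vector.subspace (Domain T)"
  proof (rule complex_vector.subspaceI)
    show "0 \<in> Domain T" using T by blast
    show "x + y \<in> Domain T" if "x \<in> Domain T" "y \<in> Domain T" for x y using that T by blast
    show "c *\<^sub>C x \<in> Domain T" if "x \<in> Domain T" for c x using that T by blast
  qed
  moreover have "clinear_on (Domain T) (op_app T)"
    unfolding clinear_on_def
  proof (intro conjI ballI allI)
    fix x y assume "x \<in> Domain T" "y \<in> Domain T"
    then obtain g g' where "(x, g) \<in> T" "(y, g') \<in> T" by blast
    moreover from this have "(x + y, g + g') \<in> T" using T by blast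
    ultimately show "op_app T (x + y) = op_app T x + op_app T y" by (simp add: op_app_eq[OF sv])
  next
    fix c x assume "x \<in> Domain T"
    then obtain g where "(x, g) \<in> T" by blast
    moreover from this have "(c *\<^sub>C x, c *\<^sub>C g) \<in> T" using T by blast
    ultimately show "op_app T (c *\<^sub>C x) = c *\<^sub>C op_app T x" by (simp add: op_app_eq[OF sv])
  qed
  ultimately show "linear_op T" using sv by (simp add: linear_op_def)
qed

lemma linear_opD:
  assumes "linear_op T"
  shows linear_op_single_valued: "single_valued T"
    and linear_op_zero: "(0, 0) \<in> T"
    and linear_op_add: "(f, g) \<in> T \<Longrightarrow> (f', g') \<in> T \<Longrightarrow> (f + f', g + g') \<in> T"
    and linear_op_scaleC: "(f, g) \<in> T \<Longrightarrow> (c *\<^sub>C f, c *\<^sub>C g) \<in> T"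
    and linear_op_scaleR: "(f, g) \<in> T \<Longrightarrow> (r *\<^sub>R f, r *\<^sub>R g) \<in> T"
    and linear_op_app: "(f, g) \<in> T \<Longrightarrow> op_app T f = g"
  using assms op_app_eq[of T] unfolding linear_op_iff scaleR_scaleC by blast+

lemma linear_op_diff:
  assumes "linear_op T" "(f, g) \<in> T" "(f', g') \<in> T"
  shows "(f - f', g - g') \<in> T"
  using linear_op_add[OF assms(1,2) linear_op_scaleR[OF assms(1,3), of "- 1"]] by simp

lemma linear_op_mem: "linear_op T \<Longrightarrow> f \<in> Domain T \<Longrightarrow> (f, op_app T f) \<in> T"
  using linear_op_app by auto

lemma subspace_Domain: "linear_op T \<Longrightarrow> subspace (Domain T)"
  by (simp add: linear_op_def subspace_if_complex_subspace)

lemma linear_op_app_real: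
  assumes T: "linear_op T"
  shows op_app_add: "f \<in> Domain T \<Longrightarrow> g \<in> Domain T \<Longrightarrow> op_app T (f + g) = op_app T f + op_app T g"
    and op_app_diff: "f \<in> Domain T \<Longrightarrow> g \<in> Domain T \<Longrightarrow> op_app T (f - g) = op_app T f - op_app T g"
    and op_app_scaleR: "f \<in> Domain T \<Longrightarrow> op_app T (r *\<^sub>R f) = r *\<^sub>R op_app T f"
  by (rule linear_op_app[OF T], rule linear_op_add[OF T] linear_op_diff[OF T] linear_op_scaleR[OF T];
      simp add: linear_op_mem[OF T])+

text \<open>The graph is invariant under multiplication by \<i>, so testing the real identity at
  \<open>\<i> *\<^sub>C f\<close> recovers the imaginary part of the complex one.\<close>

lemma op_adj_iff:
  assumes T: "linear_op T"
  shows "(g, h) \<in> op_adj T \<longleftrightarrow> (\<forall>f k. (f, k) \<in> T \<longrightarrow> g \<bullet> k = h \<bullet> f)"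
proof
  assume "(g, h) \<in> op_adj T"
  then have *: "\<forall>f\<in>Domain T. cinner g (op_app T f) = cinner h f" by (simp add: op_adj_def)
  show "\<forall>f k. (f, k) \<in> T \<longrightarrow> g \<bullet> k = h \<bullet> f"
  proof (intro allI impI)
    fix f k assume "(f, k) \<in> T"
    then have "cinner g k = cinner h f" using * linear_op_app[OF T] by blast
    then show "g \<bullet> k = h \<bullet> f" by (simp add: Re_cinner[symmetric])
  qed
next
  assume *: "\<forall>f k. (f, k) \<in> T \<longrightarrow> g \<bullet> k = h \<bullet> f"
  have "cinner g (op_app T f) = cinner h f" if "f \<in> Domain T" for f
  proof (rule complex_eqI)
    have fk: "(f, op_app T f) \<in> T" using linear_op_mem[OF T that] .
    show "Re (cinner g (op_app T f)) = Re (cinner h f)"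
      using * fk by (simp add: Re_cinner)
    show "Im (cinner g (op_app T f)) = Im (cinner h f)"
      using * linear_op_scaleC[OF T fk, of "\<i>"] by (simp add: Im_cinner)
  qed
  then show "(g, h) \<in> op_adj T" by (simp add: op_adj_def)
qed

lemma closed_op_adj:
  fixes T :: "'a::chilbert_space operator"
  assumes "linear_op T"
  shows "closed (op_adj T)"
proof -
  have "op_adj T = (\<Inter>p\<in>T. {x. fst x \<bullet> snd p = snd x \<bullet> fst p})"
    using op_adj_iff[OF assms] by force
  moreover have "closed \<dots>"
    by (intro closed_INT ballI closed_Collect_eq continuous_intros)
  ultimately show ?thesis by simp
qed

lemma densely_defined_linear: "densely_defined T \<Longrightarrow> linear_op T"
  by (simp add: densely_defined_def)

lemma densely_defined_orthogonal:
  assumes "densely_defined T" "\<And>f. f \<in> Domain T \<Longrightarrow> y \<bullet> f = 0"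
  shows "y = 0"
  using assms dense_iff_orthogonal[OF subspace_Domain, of T] by (auto simp: densely_defined_def)

lemma linear_op_adj:
  fixes T :: "'a::chilbert_space operator"
  assumes "densely_defined T"
  shows "linear_op (op_adj T)"
proof -
  have T: "linear_op T" using assms by (rule densely_defined_linear)
  note iff = op_adj_iff[OF T]
  have "single_valued (op_adj T)"
  proof (rule single_valuedI)
    fix g h h' assume "(g, h) \<in> op_adj T" "(g, h') \<in> op_adj T"
    then have "h - h' = 0"
      by (intro densely_defined_orthogonal[OF assms]) (auto simp: iff inner_diff_left)
    then show "h = h'" by simp
  qed
  moreover have "(c *\<^sub>C f, c *\<^sub>C g) \<in> op_adj T" if "(f, g) \<in> op_adj T" for c f g
  proof -
    have "(c *\<^sub>C f) \<bullet> k = (c *\<^sub>C g) \<bullet> x" if "(x, k) \<in> T" for x k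
      using \<open>(f, g) \<in> op_adj T\<close> linear_op_scaleC[OF T that, of "cnj c"]
      unfolding iff inner_scaleC_left by blast
    then show ?thesis unfolding iff by blast
  qed
  ultimately show ?thesis unfolding linear_op_iff by (auto simp: iff inner_add_left)
qed

lemma selfadjoint_iff_graph:
  assumes "selfadjoint T"
  shows "(g, h) \<in> T \<longleftrightarrow> (\<forall>f k. (f, k) \<in> T \<longrightarrow> g \<bullet> k = h \<bullet> f)"
  using assms op_adj_iff[of T g h] by (simp add: selfadjoint_def densely_defined_def)

lemma selfadjoint_linear: "selfadjoint T \<Longrightarrow> linear_op T"
  by (simp add: selfadjoint_def densely_defined_def)

text \<open>
  Von Neumann's theorem that \<open>1 + t B\<^sup>2\<close> is onto: apply the Riesz representation to the graph norm.
\<close>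

lemma selfadjoint_resolvent_square:
  fixes B :: "'a::chilbert_space operator"
  assumes B: "selfadjoint B" and "0 < t"
  obtains f g k where "(f, g) \<in> B" "(g, k) \<in> B" "h = f + t *\<^sub>R k"
proof -
  have lin: "linear_op B" using B by (rule selfadjoint_linear)
  define q where "q f g = f \<bullet> g + t * (op_app B f \<bullet> op_app B g)" for f g
  interpret nonneg_form "Domain B" q
  proof
    show "q f g = q g f" for f g by (simp add: q_def inner_commute)
    show "0 \<le> q f f" for f using \<open>0 < t\<close> by (simp add: q_def)
  qed (use op_app_add[OF lin] op_app_scaleR[OF lin] subspace_Domain[OF lin]
        in \<open>auto simp: q_def inner_add_left algebra_simps\<close>)
  have "\<exists>u. (\<forall>n::nat. u n \<in> Domain B) \<and>
    (\<forall>e>0. \<exists>N. \<forall>m\<ge>N. \<forall>n\<ge>N. q (u m - u n) (u m - u n) < e) \<and>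
    (\<forall>g\<in>Domain B. (\<lambda>n. q (u n) g) \<longlonglongrightarrow> h \<bullet> g)"
  proof (rule Riesz_sequence[where C = "h \<bullet> h"])
    fix f
    have "(h \<bullet> f)\<^sup>2 \<le> (h \<bullet> h) * (f \<bullet> f)" by (rule Cauchy_Schwarz_ineq)
    also have "\<dots> \<le> (h \<bullet> h) * q f f" using \<open>0 < t\<close> by (intro mult_left_mono) (auto simp: q_def)
    finally show "(h \<bullet> f)\<^sup>2 \<le> (h \<bullet> h) * q f f" .
  qed (simp_all add: inner_add_right)
  then obtain u where u: "\<And>n::nat. u n \<in> Domain B"
    and Cauchy_u: "\<And>e. e > 0 \<Longrightarrow> \<exists>N. \<forall>m\<ge>N. \<forall>n\<ge>N. q (u m - u n) (u m - u n) < e"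
    and lim_u: "\<And>g. g \<in> Domain B \<Longrightarrow> (\<lambda>n. q (u n) g) \<longlonglongrightarrow> h \<bullet> g"
    by blast
  \<comment> \<open>The form is a squared graph norm with weight \<open>t\<close>, so
    \<open>u\<close> and its images are both Cauchy, and closedness of \<open>B\<close> puts the
    pair of limits into \<open>B\<close>.\<close>
  have q_diff: "q (u m - u n) (u m - u n) =
      (norm (u m - u n))\<^sup>2 + t * (norm (op_app B (u m) - op_app B (u n)))\<^sup>2" for m n
    unfolding q_def by (simp add: op_app_diff[OF lin u u] power2_norm_eq_inner)
  have "Cauchy u"
  proof (rule Cauchy_if_norm_diff_square)
    fix e :: real assume "0 < e"
    then obtain N where N: "\<forall>m\<ge>N. \<forall>n\<ge>N. q (u m - u n) (u m - u n) < e" using Cauchy_u by blast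
    have "(norm (u m - u n))\<^sup>2 \<le> q (u m - u n) (u m - u n)" for m n
      unfolding q_diff using \<open>0 < t\<close> by simp
    with N show "\<exists>N. \<forall>m\<ge>N. \<forall>n\<ge>N. (norm (u m - u n))\<^sup>2 < e" by (meson le_less_trans)
  qed
  then obtain f where f: "u \<longlonglongrightarrow> f" using Cauchy_convergent_iff convergent_def by blast
  have "Cauchy (\<lambda>n. op_app B (u n))"
  proof (rule Cauchy_if_norm_diff_square)
    fix e :: real assume "0 < e"
    then have "0 < t * e" using \<open>0 < t\<close> by simp
    then obtain N where N: "\<forall>m\<ge>N. \<forall>n\<ge>N. q (u m - u n) (u m - u n) < t * e" using Cauchy_u by blast
    have "(norm (op_app B (u m) - op_app B (u n)))\<^sup>2 < e" if "m \<ge> N" "n \<ge> N" for m n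
    proof -
      have "t * (norm (op_app B (u m) - op_app B (u n)))\<^sup>2 \<le> q (u m - u n) (u m - u n)"
        unfolding q_diff by simp
      also have "\<dots> < t * e" using N that by blast
      finally show ?thesis using \<open>0 < t\<close> by simp
    qed
    then show "\<exists>N. \<forall>m\<ge>N. \<forall>n\<ge>N. (norm (op_app B (u m) - op_app B (u n)))\<^sup>2 < e" by blast
  qed
  then obtain g where g: "(\<lambda>n. op_app B (u n)) \<longlonglongrightarrow> g" using Cauchy_convergent_iff convergent_def by blast
  have "closed B" using closed_op_adj[OF lin] B by (simp add: selfadjoint_def)
  then have fg: "(f, g) \<in> B"
    using closed_sequentially[OF _ _ tendsto_Pair[OF f g]] linear_op_mem[OF lin u] by blast
  have eq: "f \<bullet> w + t * (g \<bullet> k) = h \<bullet> w" if "(w, k) \<in> B" for w k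
  proof (rule LIMSEQ_unique)
    have w: "w \<in> Domain B" "op_app B w = k" using that linear_op_app[OF lin] by auto
    show "(\<lambda>n. u n \<bullet> w + t * (op_app B (u n) \<bullet> k)) \<longlonglongrightarrow> f \<bullet> w + t * (g \<bullet> k)"
      by (intro tendsto_intros f g)
    show "(\<lambda>n. u n \<bullet> w + t * (op_app B (u n) \<bullet> k)) \<longlonglongrightarrow> h \<bullet> w"
      using lim_u[OF w(1)] by (simp add: q_def w(2))
  qed
  \<comment> \<open>By \<open>eq\<close>, pairing \<open>g\<close> with an image under
    \<open>B\<close> equals pairing \<open>(h - f) / t\<close> with the argument. Thus
    \<open>g\<close> lies in the domain of the adjoint of \<open>B\<close>, which is
    \<open>B\<close>.\<close>
  have "(g, (1 / t) *\<^sub>R (h - f)) \<in> B"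
  proof (rule selfadjoint_iff_graph[OF B, THEN iffD2], intro allI impI)
    fix w k assume "(w, k) \<in> B"
    then have "(h - f) \<bullet> w = t * (g \<bullet> k)" using eq[of w k] by (simp add: inner_diff_left)
    then show "g \<bullet> k = ((1 / t) *\<^sub>R (h - f)) \<bullet> w"
      using \<open>0 < t\<close> by simp
  qed
  moreover have "h = f + t *\<^sub>R ((1 / t) *\<^sub>R (h - f))" using \<open>0 < t\<close> by simp
  ultimately show ?thesis using that fg by blast
qed

section \<open>Square roots and pseudoinverses of bounded nonnegative operators\<close>

locale bounded_nonneg_op =
  fixes M :: "'a::chilbert_space \<Rightarrow> 'a"
  assumes add: "M (x + y) = M x + M y"
    and scaleC: "M (c *\<^sub>C x) = c *\<^sub>C M x"
    and bounded: "\<exists>C. \<forall>x. norm (M x) \<le> norm x * C"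
    and symmetric: "M x \<bullet> y = x \<bullet> M y"
    and nonneg: "0 \<le> x \<bullet> M x"
begin

lemma scaleR: "M (r *\<^sub>R x) = r *\<^sub>R M x"
  by (simp add: scaleR_scaleC scaleC)

lemma zero [simp]: "M 0 = 0"
  using scaleR[of 0 0] by simp

lemma diff: "M (x - y) = M x - M y"
  using add[of "x - y" y] by simp

lemma bounded_linear: "bounded_linear M"
  using bounded by (auto simp: add scaleR intro: bounded_linear_intro)

lemma kernel_square: "M (M x) = 0 \<longleftrightarrow> M x = 0"
proof
  assume "M (M x) = 0"
  then have "M x \<bullet> M x = 0" by (simp add: symmetric)
  then show "M x = 0" by simp
qed simp

end

section \<open>Square roots of bounded nonnegative operators\<close>

text \<open>Cauchy-Schwarz for the form of \<open>X\<close> at the pair \<open>x\<close>,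
  \<open>X x\<close> bounds the fourth power of \<open>norm (X x)\<close> by the product of the form
  values at \<open>x\<close> and \<open>X x\<close>, hence by the squared norms of both.\<close>

lemma norm_le_if_form_bounds:
  fixes X :: "'a::real_inner \<Rightarrow> 'a"
  assumes "linear X" and sym: "\<And>x y. X x \<bullet> y = x \<bullet> X y"
    and pos: "\<And>x. 0 \<le> x \<bullet> X x" and le: "\<And>x. x \<bullet> X x \<le> x \<bullet> x"
  shows "norm (X x) \<le> norm x"
proof -
  interpret linear X by fact
  interpret nonneg_form UNIV "\<lambda>x y. X x \<bullet> y"
  proof
    show "X f \<bullet> g = X g \<bullet> f" for f g using sym[of f g] by (simp add: inner_commute)
    show "0 \<le> X f \<bullet> f" for f using pos[of f] by (simp add: inner_commute)
  qed (simp_all add: add scale inner_add_left)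
  have "(X x \<bullet> X x)\<^sup>2 \<le> (X x \<bullet> x) * (X (X x) \<bullet> X x)"
    by (rule Cauchy_Schwarz) simp_all
  also have "\<dots> \<le> (x \<bullet> x) * (X x \<bullet> X x)"
    by (rule mult_mono) (use pos[of x] pos[of "X x"] le[of x] le[of "X x"] in
      \<open>simp_all add: inner_commute\<close>)
  finally have "(X x \<bullet> X x) * (X x \<bullet> X x) \<le> (x \<bullet> x) * (X x \<bullet> X x)"
    by (simp add: power2_eq_square)
  then have "X x \<bullet> X x \<le> x \<bullet> x"
    using inner_ge_zero[of "X x"] inner_ge_zero[of x] by (metis less_eq_real_def mult_le_cancel_right not_le)
  then show ?thesis by (simp add: norm_le)
qed

text \<open>
  For \<open>0 \<le> X \<le> 1\<close> the iteration \<open>Y \<mapsto> (X + Y\<^sup>2) / 2\<close> started at \<open>0\<close> is dominated in norm by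
  the scalar iteration \<open>r \<mapsto> (1 + r\<^sup>2) / 2\<close>; its limit satisfies \<open>(1 - Y)\<^sup>2 = 1 - X\<close>.
\<close>

lemma bounded_nonneg_sqrt_contraction:
  fixes X :: "'a::chilbert_space \<Rightarrow>\<^sub>L 'a"
  assumes "norm X \<le> 1" and sym: "\<And>x y. X x \<bullet> y = x \<bullet> X y"
    and complex: "\<And>c x. X (c *\<^sub>C x) = c *\<^sub>C X x"
  shows "\<exists>Y :: 'a \<Rightarrow>\<^sub>L 'a. norm Y \<le> 1 \<and>
    (\<forall>x y. blinfun_apply Y x \<bullet> y = x \<bullet> blinfun_apply Y y) \<and>
    (\<forall>c x. blinfun_apply Y (c *\<^sub>C x) = c *\<^sub>C blinfun_apply Y x) \<and>
    (\<forall>x. 2 *\<^sub>R blinfun_apply Y x = blinfun_apply X x + blinfun_apply Y (blinfun_apply Y x))"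
proof -
  define Y :: "nat \<Rightarrow> ('a \<Rightarrow>\<^sub>L 'a)" where "Y = rec_nat 0 (\<lambda>_ Z. (1/2) *\<^sub>R (X + (Z o\<^sub>L Z)))"
  define r :: "nat \<Rightarrow> real" where "r = rec_nat 0 (\<lambda>_ s. (1 + s\<^sup>2) / 2)"
  have Y0: "Y 0 = 0" and Y_Suc: "Y (Suc n) = (1/2) *\<^sub>R (X + (Y n o\<^sub>L Y n))" for n
    by (simp_all add: Y_def)
  have r0: "r 0 = 0" and r_Suc: "r (Suc n) = (1 + (r n)\<^sup>2) / 2" for n
    by (simp_all add: r_def)
  have r_bounds: "0 \<le> r n \<and> r n \<le> 1" for n
    by (induction n) (auto simp: r0 r_Suc power_le_one)
  have norm_Y: "norm (Y n) \<le> r n" for n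
  proof (induction n)
    case (Suc n)
    have "norm (X + (Y n o\<^sub>L Y n)) \<le> norm X + norm (Y n) * norm (Y n)"
      by (rule order_trans[OF norm_triangle_ineq]) (simp add: norm_blinfun_compose)
    also have "\<dots> \<le> 1 + r n * r n"
      using Suc \<open>norm X \<le> 1\<close> r_bounds by (intro add_mono mult_mono) auto
    finally show ?case by (simp add: Y_Suc r_Suc power2_eq_square)
  qed (simp add: Y0 r0)
  have step: "norm (Y (Suc n) - Y n) \<le> r (Suc n) - r n" for n
  proof (induction n)
    case 0
    show ?case using \<open>norm X \<le> 1\<close> by (simp add: Y_Suc r_Suc Y0 r0)
  next
    case (Suc n)
    let ?d = "Y (Suc n) - Y n"
    \<comment> \<open>A difference of squares factored without commuting the two iterates.\<close>
    have "Y (Suc (Suc n)) - Y (Suc n) = (1/2) *\<^sub>R ((Y (Suc n) o\<^sub>L ?d) + (?d o\<^sub>L Y n))"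
    proof -
      have "Y (Suc (Suc n)) - Y (Suc n) =
          (1/2) *\<^sub>R (X + (Y (Suc n) o\<^sub>L Y (Suc n))) - (1/2) *\<^sub>R (X + (Y n o\<^sub>L Y n))"
        by (rule arg_cong2[of _ _ _ _ minus]) (rule Y_Suc)+
      also have "\<dots> = (1/2) *\<^sub>R ((Y (Suc n) o\<^sub>L ?d) + (?d o\<^sub>L Y n))"
        by (rule blinfun_eqI) (simp add: blinfun.bilinear_simps algebra_simps)
      finally show ?thesis .
    qed
    then have "norm (Y (Suc (Suc n)) - Y (Suc n)) \<le> (norm (Y (Suc n) o\<^sub>L ?d) + norm (?d o\<^sub>L Y n)) / 2"
      by (simp add: norm_triangle_ineq)
    also have "\<dots> \<le> (norm (Y (Suc n)) * norm ?d + norm ?d * norm (Y n)) / 2"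
      by (intro divide_right_mono add_mono norm_blinfun_compose) simp
    also have "\<dots> \<le> (r (Suc n) * (r (Suc n) - r n) + (r (Suc n) - r n) * r n) / 2"
      using Suc norm_Y[of n] norm_Y[of "Suc n"] r_bounds order_trans[OF norm_ge_zero Suc]
      by (intro divide_right_mono add_mono mult_mono) auto
    also have "\<dots> = (1 + (r (Suc n))\<^sup>2) / 2 - (1 + (r n)\<^sup>2) / 2"
      by (simp add: power2_eq_square algebra_simps diff_divide_distrib add_divide_distrib)
    also have "\<dots> = r (Suc (Suc n)) - r (Suc n)"
      by (rule arg_cong2[of _ _ _ _ minus]) (rule r_Suc[symmetric])+
    finally show ?case .
  qed
  have diff: "norm (Y (n + k) - Y n) \<le> r (n + k) - r n" for n k
  proof (induction k)
    case (Suc k)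
    have "norm (Y (n + Suc k) - Y n) \<le> norm (Y (Suc (n + k)) - Y (n + k)) + norm (Y (n + k) - Y n)"
      using norm_triangle_ineq[of "Y (Suc (n + k)) - Y (n + k)" "Y (n + k) - Y n"] by simp
    then show ?case using Suc step[of "n + k"] by simp
  qed simp
  \<comment> \<open>Each increment of \<open>r\<close> dominates a norm and is therefore
    nonnegative. Being bounded by 1, \<open>r\<close> converges, and its increments dominate those
    of \<open>Y\<close>.\<close>
  have "incseq r"
  proof (rule incseq_SucI)
    fix n
    show "r n \<le> r (Suc n)" using step[of n] norm_ge_zero[of "Y (Suc n) - Y n"] by linarith
  qed
  then have "convergent r"
    using r_bounds by (metis incseq_convergent convergent_def)
  then have "Cauchy r" by (simp add: Cauchy_convergent_iff)
  have "Cauchy Y"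
  proof (rule CauchyI')
    fix e :: real assume "0 < e"
    then obtain N where N: "\<forall>m\<ge>N. \<forall>n\<ge>N. dist (r m) (r n) < e"
      using \<open>Cauchy r\<close> unfolding Cauchy_def by blast
    have "dist (Y m) (Y n) < e" if "m \<ge> N" "n > m" for m n
    proof -
      have "dist (Y m) (Y n) \<le> r n - r m"
        using diff[of m "n - m"] that by (simp add: dist_norm norm_minus_commute)
      also have "\<dots> \<le> dist (r n) (r m)" by (simp add: dist_real_def)
      also have "\<dots> < e" using N that by simp
      finally show ?thesis .
    qed
    then show "\<exists>M. \<forall>m\<ge>M. \<forall>n>m. dist (Y m) (Y n) < e" by blast
  qed
  then obtain Z where Z: "Y \<longlonglongrightarrow> Z" using Cauchy_convergent_iff convergent_def by blast
  have Zx: "(\<lambda>n. Y n x) \<longlonglongrightarrow> Z x" for x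
    by (intro tendsto_intros Z)
  have sym_Y: "Y n x \<bullet> y = x \<bullet> Y n y" for n x y
    by (induction n arbitrary: x y)
       (simp_all add: Y0 Y_Suc blinfun.bilinear_simps inner_add_left inner_add_right sym)
  have complex_Y: "Y n (c *\<^sub>C x) = c *\<^sub>C Y n x" for n c x
    by (induction n arbitrary: x)
       (simp_all add: Y0 Y_Suc blinfun.bilinear_simps complex scaleC_add_right scaleR_scaleC
          scaleC_scaleC mult.commute)
  show ?thesis
  proof (intro exI[of _ Z] conjI allI)
    have "norm (Y n) \<le> 1" for n using norm_Y[of n] r_bounds[of n] by linarith
    then show "norm Z \<le> 1" using LIMSEQ_le_const2[OF tendsto_norm[OF Z], of 1] by blast
    show "Z x \<bullet> y = x \<bullet> Z y" for x y
    proof (rule LIMSEQ_unique)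
      show "(\<lambda>n. Y n x \<bullet> y) \<longlonglongrightarrow> Z x \<bullet> y" by (intro tendsto_intros Zx)
      show "(\<lambda>n. Y n x \<bullet> y) \<longlonglongrightarrow> x \<bullet> Z y" unfolding sym_Y by (intro tendsto_intros Zx)
    qed
    show "Z (c *\<^sub>C x) = c *\<^sub>C Z x" for c x
    proof (rule LIMSEQ_unique)
      show "(\<lambda>n. Y n (c *\<^sub>C x)) \<longlonglongrightarrow> Z (c *\<^sub>C x)" by (rule Zx)
      show "(\<lambda>n. Y n (c *\<^sub>C x)) \<longlonglongrightarrow> c *\<^sub>C Z x" unfolding complex_Y by (intro tendsto_scaleC Zx)
    qed
    have "Z = (1/2) *\<^sub>R (X + (Z o\<^sub>L Z))"
    proof (rule LIMSEQ_unique)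
      show "(\<lambda>n. Y (Suc n)) \<longlonglongrightarrow> Z" using Z by (rule LIMSEQ_Suc)
      show "(\<lambda>n. Y (Suc n)) \<longlonglongrightarrow> (1/2) *\<^sub>R (X + (Z o\<^sub>L Z))"
        unfolding Y_Suc
        by (intro tendsto_intros Z bounded_bilinear.tendsto[OF bounded_bilinear_blinfun_compose])
    qed
    then have "2 *\<^sub>R Z = X + (Z o\<^sub>L Z)" by (metis scaleR_half_double scaleR_2 scaleR_add_right)
    then show "2 *\<^sub>R Z x = X x + Z (Z x)" for x
      by (metis blinfun.add_left blinfun.scaleR_left blinfun_apply_blinfun_compose)
  qed
qed

context bounded_nonneg_op
begin

text \<open>Dividing by a norm bound \<open>C\<close> makes \<open>X = 1 - M / C\<close> satisfy the
  hypotheses of the iteration, and \<open>sqrt C\<close> times \<open>1 - Y\<close> is the root. It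
  is nonnegative because \<open>norm Y\<close> is at most 1.\<close>

lemma sqrt_exists: "\<exists>N. bounded_nonneg_op N \<and> (\<forall>x. N (N x) = M x)"
proof -
  obtain C where C: "0 < C" "\<And>x. norm (M x) \<le> norm x * C"
    using bounded_linear.pos_bounded[OF bounded_linear] by blast
  define X where "X x = x - (1 / C) *\<^sub>R M x" for x
  have lin: "linear X"
    by (rule linearI) (simp_all add: X_def add scaleR algebra_simps)
  have X_sym: "X x \<bullet> y = x \<bullet> X y" for x y
    by (simp add: X_def inner_diff_left inner_diff_right symmetric)
  have X_le: "x \<bullet> X x \<le> x \<bullet> x" for x
    using nonneg[of x] C by (simp add: X_def inner_diff_right)
  have X_nonneg: "0 \<le> x \<bullet> X x" for x
  proof -
    have "x \<bullet> M x \<le> norm x * norm (M x)" by (rule norm_cauchy_schwarz)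
    also have "\<dots> \<le> norm x * (norm x * C)" using C by (intro mult_left_mono) auto
    also have "\<dots> = C * (x \<bullet> x)" by (simp add: norm_eq_sqrt_inner)
    finally show ?thesis using C by (simp add: X_def inner_diff_right field_simps)
  qed
  have X_norm: "norm (X x) \<le> norm x" for x
    using lin X_sym X_nonneg X_le by (rule norm_le_if_form_bounds)
  have bl: "bounded_linear X"
    using lin X_norm by (intro bounded_linear_intro[of X 1]) (auto simp: linear_add linear_scale)
  define XX where "XX = Blinfun X"
  have XX: "blinfun_apply XX = X" unfolding XX_def by (rule bounded_linear_Blinfun_apply[OF bl])
  have "\<exists>Y :: 'a \<Rightarrow>\<^sub>L 'a. norm Y \<le> 1 \<and>
    (\<forall>x y. blinfun_apply Y x \<bullet> y = x \<bullet> blinfun_apply Y y) \<and>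
    (\<forall>c x. blinfun_apply Y (c *\<^sub>C x) = c *\<^sub>C blinfun_apply Y x) \<and>
    (\<forall>x. 2 *\<^sub>R blinfun_apply Y x = blinfun_apply XX x + blinfun_apply Y (blinfun_apply Y x))"
  proof (rule bounded_nonneg_sqrt_contraction)
    show "norm XX \<le> 1" by (rule norm_blinfun_bound) (simp_all add: XX X_norm)
    show "XX x \<bullet> y = x \<bullet> XX y" for x y by (simp add: XX X_sym)
    show "XX (c *\<^sub>C x) = c *\<^sub>C XX x" for c x
      by (simp add: XX X_def scaleC complex_vector.scale_right_diff_distrib scaleR_scaleC
          scaleC_scaleC mult.commute)
  qed
  then obtain Y :: "'a \<Rightarrow>\<^sub>L 'a" where Y: "norm Y \<le> 1" "\<And>x y. Y x \<bullet> y = x \<bullet> Y y"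
    "\<And>c x. Y (c *\<^sub>C x) = c *\<^sub>C Y x" "\<And>x. 2 *\<^sub>R Y x = XX x + Y (Y x)"
    by blast
  have Y_norm: "norm (Y x) \<le> norm x" for x
    using norm_blinfun[of Y x] mult_right_mono[OF Y(1) norm_ge_zero[of x]] by simp
  define N where "N x = sqrt C *\<^sub>R (x - Y x)" for x
  have "bounded_nonneg_op N"
  proof
    show "N (x + y) = N x + N y" for x y by (simp add: N_def blinfun.bilinear_simps algebra_simps)
    show "N (c *\<^sub>C x) = c *\<^sub>C N x" for c x
      by (simp add: N_def Y complex_vector.scale_right_diff_distrib[symmetric] scaleR_scaleC
          scaleC_scaleC mult.commute)
    have "norm (x - Y x) \<le> 2 * norm x" for x
      using norm_triangle_ineq4[of x "Y x"] Y_norm[of x] by simp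
    then have "norm (N x) \<le> norm x * (2 * sqrt C)" for x
      using C by (simp add: N_def mult_ac)
    then show "\<exists>C. \<forall>x. norm (N x) \<le> norm x * C" by blast
    show "N x \<bullet> y = x \<bullet> N y" for x y by (simp add: N_def inner_diff_left inner_diff_right Y)
    have "x \<bullet> Y x \<le> x \<bullet> x" for x
    proof -
      have "x \<bullet> Y x \<le> norm x * norm (Y x)" by (rule norm_cauchy_schwarz)
      also have "\<dots> \<le> norm x * norm x" by (intro mult_left_mono Y_norm) simp
      finally show ?thesis by (simp add: norm_eq_sqrt_inner)
    qed
    then show "0 \<le> x \<bullet> N x" for x using C by (simp add: N_def inner_diff_right)
  qed
  moreover have "N (N x) = M x" for x
  proof -
    have "N (N x) = C *\<^sub>R (x - 2 *\<^sub>R Y x + Y (Y x))"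
      using C by (simp add: N_def blinfun.bilinear_simps algebra_simps scaleR_2)
    also have "\<dots> = C *\<^sub>R (x - X x)" by (simp add: Y XX)
    also have "\<dots> = M x" using C by (simp add: X_def)
    finally show ?thesis .
  qed
  ultimately show ?thesis by blast
qed

end

section \<open>Pseudoinverses\<close>

text \<open>For \<open>M\<close> in \<open>bounded_nonneg_op\<close> this is the Moore-Penrose
  inverse: it sends kernel vectors to 0 and \<open>M g\<close> to \<open>g\<close> for
  \<open>g\<close> orthogonal to the kernel. For injective \<open>M\<close> it is the
  inverse.\<close>

definition pseudoinverse :: "('a::chilbert_space \<Rightarrow> 'a) \<Rightarrow> 'a operator" where
  "pseudoinverse M = {(x, g). M (x - M g) = 0 \<and> (\<forall>z. M z = 0 \<longrightarrow> g \<bullet> z = 0)}"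

context bounded_nonneg_op
begin

lemma kernel_pseudoinverse: "M z = 0 \<Longrightarrow> (z, 0) \<in> pseudoinverse M"
  by (simp add: pseudoinverse_def)

text \<open>Symmetry makes \<open>M w\<close> orthogonal to the kernel, whereas \<open>w\<close>
  itself need not be. Together with the kernel vectors these pairs are the test vectors for density
  and selfadjointness.\<close>

lemma range_pseudoinverse: "(M (M w), M w) \<in> pseudoinverse M"
  by (simp add: pseudoinverse_def symmetric)

text \<open>Since \<open>k\<close> is orthogonal to the kernel, \<open>x\<close> may be replaced by
  \<open>M g\<close>. The resulting expression makes both symmetry and nonnegativity
  visible.\<close>

lemma inner_pseudoinverse:
  assumes "(x, g) \<in> pseudoinverse M" "(y, k) \<in> pseudoinverse M"
  shows "x \<bullet> k = g \<bullet> M k"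
proof -
  have "k \<bullet> (x - M g) = 0" using assms by (auto simp: pseudoinverse_def)
  then have "k \<bullet> x = M k \<bullet> g" by (simp add: inner_diff_right symmetric)
  then show ?thesis by (simp add: inner_commute)
qed

lemma densely_defined_pseudoinverse: "densely_defined (pseudoinverse M)"
proof -
  have "single_valued (pseudoinverse M)"
  proof (rule single_valuedI)
    fix x g h assume "(x, g) \<in> pseudoinverse M" "(x, h) \<in> pseudoinverse M"
    then have *: "M x = M (M g)" "M x = M (M h)" "\<And>z. M z = 0 \<Longrightarrow> (g - h) \<bullet> z = 0"
      by (auto simp: pseudoinverse_def diff inner_diff_left)
    then have "M (M (g - h)) = 0" by (simp add: diff)
    then have "M (g - h) = 0" by (simp add: kernel_square)
    then have "(g - h) \<bullet> (g - h) = 0" by (rule *(3))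
    then show "g = h" by simp
  qed
  then have lin: "linear_op (pseudoinverse M)"
    unfolding linear_op_iff
  proof (intro conjI allI impI)
    show "(0, 0) \<in> pseudoinverse M" by (simp add: kernel_pseudoinverse)
    show "(f + f', g + g') \<in> pseudoinverse M"
      if "(f, g) \<in> pseudoinverse M" "(f', g') \<in> pseudoinverse M" for f g f' g'
      using that by (simp add: pseudoinverse_def add diff inner_add_left)
    show "(c *\<^sub>C f, c *\<^sub>C g) \<in> pseudoinverse M" if "(f, g) \<in> pseudoinverse M" for c f g
      using that by (simp add: pseudoinverse_def scaleC diff inner_scaleC_left)
  qed
  moreover have "y = 0" if y: "\<And>z. z \<in> Domain (pseudoinverse M) \<Longrightarrow> y \<bullet> z = 0" for y
  proof -
    \<comment> \<open>The range vectors force \<open>M y = 0\<close>; then \<open>y\<close> is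
      itself in the domain, as a kernel vector.\<close>
    have "y \<bullet> M (M y) = 0" using range_pseudoinverse by (intro y) blast
    then have "M y \<bullet> M y = 0" by (simp only: symmetric[of y "M y"])
    then have "M y = 0" by simp
    then have "y \<bullet> y = 0" using kernel_pseudoinverse by (intro y) blast
    then show ?thesis by simp
  qed
  ultimately show ?thesis
    using dense_iff_orthogonal[OF subspace_Domain[OF lin]] by (auto simp: densely_defined_def)
qed

text \<open>The two conditions defining the pseudoinverse are what the adjoint relation says on test
  vectors: kernel vectors give the orthogonality of \<open>h\<close>, range vectors give
  \<open>M (g - M h) = 0\<close>.\<close>

lemma selfadjoint_pseudoinverse: "selfadjoint (pseudoinverse M)"
proof -
  note lin = densely_defined_linear[OF densely_defined_pseudoinverse]
  have "(g, h) \<in> op_adj (pseudoinverse M) \<longleftrightarrow> (g, h) \<in> pseudoinverse M" for g h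
  proof
    assume "(g, h) \<in> pseudoinverse M"
    then show "(g, h) \<in> op_adj (pseudoinverse M)"
      unfolding op_adj_iff[OF lin]
      by (metis inner_pseudoinverse inner_commute symmetric)
  next
    assume "(g, h) \<in> op_adj (pseudoinverse M)"
    then have adj: "g \<bullet> k = h \<bullet> f" if "(f, k) \<in> pseudoinverse M" for f k
      using that unfolding op_adj_iff[OF lin] by blast
    have "h \<bullet> z = 0" if "M z = 0" for z
      using adj[OF kernel_pseudoinverse[OF that]] by simp
    moreover have "M (g - M h) = 0"
    proof -
      have "M (g - M h) \<bullet> w = 0" for w
        using adj[OF range_pseudoinverse, of w] by (simp add: diff inner_diff_left symmetric)
      from this[of "M (g - M h)"] show ?thesis by simp
    qed
    ultimately show "(g, h) \<in> pseudoinverse M" by (simp add: pseudoinverse_def)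
  qed
  then have "op_adj (pseudoinverse M) = pseudoinverse M" by auto
  then show ?thesis using densely_defined_pseudoinverse by (simp add: selfadjoint_def)
qed

end

lemma symmetric_op_if_selfadjoint:
  assumes "selfadjoint T"
  shows "symmetric_op T"
proof -
  have "cinner f (op_app T g) = cinner (op_app T f) g" if "f \<in> Domain T" "g \<in> Domain T" for f g
  proof -
    have "(f, op_app T f) \<in> op_adj T"
      using that linear_op_mem[OF selfadjoint_linear[OF assms]] assms by (simp add: selfadjoint_def)
    then show ?thesis using that by (simp add: op_adj_def)
  qed
  then show ?thesis using assms by (simp add: symmetric_op_def selfadjoint_def)
qed

context bounded_nonneg_op
begin

lemma nonnegative_pseudoinverse: "nonnegative (pseudoinverse M)"
proof -
  have "0 \<le> f \<bullet> op_app (pseudoinverse M) f" if "f \<in> Domain (pseudoinverse M)" for f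
  proof -
    have "(f, op_app (pseudoinverse M) f) \<in> pseudoinverse M"
      using linear_op_mem[OF selfadjoint_linear[OF selfadjoint_pseudoinverse] that] .
    from inner_pseudoinverse[OF this this] show ?thesis using nonneg by simp
  qed
  then show ?thesis
    using symmetric_op_if_selfadjoint[OF selfadjoint_pseudoinverse]
    by (simp add: nonnegative_def Re_cinner)
qed

text \<open>The intermediate vector must be \<open>M h\<close>: the difference
  \<open>g - M h\<close> lies in the kernel, while \<open>g\<close> is orthogonal to the kernel and
  so is \<open>M h\<close> by symmetry. Thus a root of \<open>M\<close> yields a root of its
  pseudoinverse.\<close>

lemma pseudoinverse_square:
  "pseudoinverse M O pseudoinverse M = pseudoinverse (\<lambda>x. M (M x))"
proof -
  have "(x, h) \<in> pseudoinverse M O pseudoinverse M \<longleftrightarrow> (x, h) \<in> pseudoinverse (\<lambda>x. M (M x))" for x h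
  proof
    assume "(x, h) \<in> pseudoinverse M O pseudoinverse M"
    then obtain g where xg: "(x, g) \<in> pseudoinverse M" and gh: "(g, h) \<in> pseudoinverse M" by blast
    have "M (g - M h) = 0" using gh by (simp add: pseudoinverse_def)
    moreover from this have "(g - M h) \<bullet> (g - M h) = 0"
      using xg by (simp add: pseudoinverse_def inner_diff_left[of g] symmetric)
    ultimately have "g = M h" by simp
    with xg gh show "(x, h) \<in> pseudoinverse (\<lambda>x. M (M x))"
      by (simp add: pseudoinverse_def kernel_square)
  next
    assume "(x, h) \<in> pseudoinverse (\<lambda>x. M (M x))"
    then have "(x, M h) \<in> pseudoinverse M" "(M h, h) \<in> pseudoinverse M"
      by (auto simp: pseudoinverse_def kernel_square symmetric)
    then show "(x, h) \<in> pseudoinverse M O pseudoinverse M" by blast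
  qed
  then show ?thesis by auto
qed

end

section \<open>The Friedrichs extension\<close>

locale strictly_positive_operator =
  fixes S :: "'a::chilbert_space operator"
  assumes strictly_positive: "strictly_positive S"
begin

lemma densely_defined: "densely_defined S"
  using strictly_positive by (simp add: strictly_positive_def symmetric_op_def)

lemma linear: "linear_op S"
  using densely_defined by (rule densely_defined_linear)

lemma linear_adj: "linear_op (op_adj S)"
  using densely_defined by (rule linear_op_adj)

lemma op_app_inner_commute:
  assumes "f \<in> Domain S" "g \<in> Domain S"
  shows "f \<bullet> op_app S g = op_app S f \<bullet> g"
proof -
  have "cinner f (op_app S g) = cinner (op_app S f) g"
    using strictly_positive assms by (simp add: strictly_positive_def symmetric_op_def)
  then show ?thesis by (simp add: Re_cinner[symmetric])
qed

lemma subset_op_adj: "S \<subseteq> op_adj S"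
proof (rule subrelI)
  fix f g assume fg: "(f, g) \<in> S"
  have "f \<bullet> k = g \<bullet> w" if "(w, k) \<in> S" for w k
    using op_app_inner_commute[of f w] fg that by (auto simp: linear_op_app[OF linear])
  then show "(f, g) \<in> op_adj S" by (simp add: op_adj_iff[OF linear])
qed

lemma lower_bound: "\<exists>\<epsilon>>0. \<forall>f g. (f, g) \<in> S \<longrightarrow> \<epsilon> * (norm f)\<^sup>2 \<le> f \<bullet> g"
  using strictly_positive linear_op_app[OF linear]
  unfolding strictly_positive_def Re_cinner by blast

sublocale form: nonneg_form "Domain S" "\<lambda>f g. f \<bullet> op_app S g"
proof
  show "subspace (Domain S)" by (rule subspace_Domain[OF linear])
  show "f \<bullet> op_app S g = g \<bullet> op_app S f" if "f \<in> Domain S" "g \<in> Domain S" for f g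
    using op_app_inner_commute[OF that] by (simp add: inner_commute)
  obtain \<epsilon> where "0 < \<epsilon>" and \<epsilon>: "\<And>f g. (f, g) \<in> S \<Longrightarrow> \<epsilon> * (norm f)\<^sup>2 \<le> f \<bullet> g" using lower_bound by blast
  show "0 \<le> f \<bullet> op_app S f" if "f \<in> Domain S" for f
  proof -
    have "0 \<le> \<epsilon> * (norm f)\<^sup>2" using \<open>0 < \<epsilon>\<close> by simp
    also have "\<dots> \<le> f \<bullet> op_app S f" by (rule \<epsilon>[OF linear_op_mem[OF linear that]])
    finally show ?thesis .
  qed
qed (simp_all add: inner_add_left)

text \<open>The parallelogram identity with the form of \<open>f - g\<close> dropped.\<close>

lemma form_add_le:
  assumes "f \<in> Domain S" "g \<in> Domain S"
  shows "(f + g) \<bullet> op_app S (f + g) \<le> 2 * (f \<bullet> op_app S f) + 2 * (g \<bullet> op_app S g)"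
  using form.nonneg[OF form.mem(3)[OF assms]] form.square_add_scale[OF assms, of 1]
    form.square_add_scale[OF assms, of "- 1"] by simp

lemma form_scaleC:
  assumes "f \<in> Domain S"
  shows "(c *\<^sub>C f) \<bullet> op_app S (c *\<^sub>C f) = (cmod c)\<^sup>2 * (f \<bullet> op_app S f)"
proof -
  have "op_app S (c *\<^sub>C f) = c *\<^sub>C op_app S f"
    using linear assms by (simp add: linear_op_def clinear_on_def)
  then have "(c *\<^sub>C f) \<bullet> op_app S (c *\<^sub>C f) = f \<bullet> (complex_of_real ((cmod c)\<^sup>2) *\<^sub>C op_app S f)"
    by (simp add: inner_scaleC_left scaleC_scaleC complex_norm_square mult.commute del: of_real_power)
  then show ?thesis by (metis scaleR_scaleC inner_scaleR_right)
qed

section \<open>Form-Cauchy sequences and the bijectivity of the Friedrichs extension\<close>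

definition form_Cauchy :: "(nat \<Rightarrow> 'a) \<Rightarrow> bool" where
  "form_Cauchy u \<longleftrightarrow> (\<forall>n. u n \<in> Domain S) \<and>
     (\<forall>e>0. \<exists>N. \<forall>m\<ge>N. \<forall>n\<ge>N. (u m - u n) \<bullet> op_app S (u m - u n) < e)"

lemma form_closure_domain_iff:
  "f \<in> form_closure_domain S \<longleftrightarrow> (\<exists>u. form_Cauchy u \<and> u \<longlonglongrightarrow> f)"
  unfolding form_closure_domain_def form_Cauchy_def Re_cinner by blast

lemma form_Cauchy_Domain: "form_Cauchy u \<Longrightarrow> u n \<in> Domain S"
  by (simp add: form_Cauchy_def)

lemma form_Cauchy_imp_Cauchy:
  assumes "form_Cauchy u"
  shows "Cauchy u"
proof (rule Cauchy_if_norm_diff_square)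
  fix e :: real assume "0 < e"
  obtain \<epsilon> where "0 < \<epsilon>" and \<epsilon>: "\<And>f g. (f, g) \<in> S \<Longrightarrow> \<epsilon> * (norm f)\<^sup>2 \<le> f \<bullet> g" using lower_bound by blast
  have "0 < \<epsilon> * e" using \<open>0 < \<epsilon>\<close> \<open>0 < e\<close> by simp
  then obtain N where N: "\<forall>m\<ge>N. \<forall>n\<ge>N. (u m - u n) \<bullet> op_app S (u m - u n) < \<epsilon> * e"
    using assms unfolding form_Cauchy_def by blast
  have "(norm (u m - u n))\<^sup>2 < e" if "m \<ge> N" "n \<ge> N" for m n
  proof -
    have "\<epsilon> * (norm (u m - u n))\<^sup>2 \<le> (u m - u n) \<bullet> op_app S (u m - u n)"
      by (intro \<epsilon> linear_op_mem[OF linear] form.mem form_Cauchy_Domain[OF assms])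
    also have "\<dots> < \<epsilon> * e" using N that by blast
    finally show ?thesis using \<open>0 < \<epsilon>\<close> by simp
  qed
  then show "\<exists>N. \<forall>m\<ge>N. \<forall>n\<ge>N. (norm (u m - u n))\<^sup>2 < e" by blast
qed

lemma form_Cauchy_add:
  assumes u: "form_Cauchy u" and v: "form_Cauchy v"
  shows "form_Cauchy (\<lambda>n. u n + v n)"
  unfolding form_Cauchy_def
proof (intro conjI allI impI)
  show "u n + v n \<in> Domain S" for n using u v by (intro form.mem form_Cauchy_Domain)
  fix e :: real assume "0 < e"
  then have "0 < e / 4" by simp
  then obtain N1 N2
    where N1: "\<forall>m\<ge>N1. \<forall>n\<ge>N1. (u m - u n) \<bullet> op_app S (u m - u n) < e / 4"
      and N2: "\<forall>m\<ge>N2. \<forall>n\<ge>N2. (v m - v n) \<bullet> op_app S (v m - v n) < e / 4"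
    using u v unfolding form_Cauchy_def by blast
  have "(u m + v m - (u n + v n)) \<bullet> op_app S (u m + v m - (u n + v n)) < e"
    if "m \<ge> max N1 N2" "n \<ge> max N1 N2" for m n
  proof -
    have eq: "u m + v m - (u n + v n) = (u m - u n) + (v m - v n)" by simp
    have "((u m - u n) + (v m - v n)) \<bullet> op_app S ((u m - u n) + (v m - v n)) \<le>
        2 * ((u m - u n) \<bullet> op_app S (u m - u n)) + 2 * ((v m - v n) \<bullet> op_app S (v m - v n))"
      using u v by (intro form_add_le form.mem form_Cauchy_Domain)
    moreover have "(u m - u n) \<bullet> op_app S (u m - u n) < e / 4" "(v m - v n) \<bullet> op_app S (v m - v n) < e / 4"
      using N1 N2 that by simp_all
    ultimately show ?thesis unfolding eq by linarith
  qed
  then show "\<exists>N. \<forall>m\<ge>N. \<forall>n\<ge>N. (u m + v m - (u n + v n)) \<bullet> op_app S (u m + v m - (u n + v n)) < e"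
    by blast
qed

lemma form_Cauchy_scaleC:
  assumes u: "form_Cauchy u"
  shows "form_Cauchy (\<lambda>n. c *\<^sub>C u n)"
  unfolding form_Cauchy_def
proof (intro conjI allI impI)
  have sub: "complex_vector.subspace (Domain S)" using linear by (simp add: linear_op_def)
  show "c *\<^sub>C u n \<in> Domain S" for n
    using form_Cauchy_Domain[OF u] by (rule complex_vector.subspace_scale[OF sub])
  fix e :: real assume "0 < e"
  \<comment> \<open>The summand 1 keeps the divisor positive when \<open>c = 0\<close>.\<close>
  then have "0 < e / ((cmod c)\<^sup>2 + 1)" by (intro divide_pos_pos add_nonneg_pos) simp_all
  then obtain N where N: "\<forall>m\<ge>N. \<forall>n\<ge>N. (u m - u n) \<bullet> op_app S (u m - u n) < e / ((cmod c)\<^sup>2 + 1)"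
    using u unfolding form_Cauchy_def by blast
  have "(c *\<^sub>C u m - c *\<^sub>C u n) \<bullet> op_app S (c *\<^sub>C u m - c *\<^sub>C u n) < e" if "m \<ge> N" "n \<ge> N" for m n
  proof -
    let ?q = "(u m - u n) \<bullet> op_app S (u m - u n)"
    have D: "u m - u n \<in> Domain S" using u by (intro form.mem form_Cauchy_Domain)
    have "(c *\<^sub>C u m - c *\<^sub>C u n) \<bullet> op_app S (c *\<^sub>C u m - c *\<^sub>C u n) = (cmod c)\<^sup>2 * ?q"
      using form_scaleC[OF D, of c] by (simp add: complex_vector.scale_right_diff_distrib)
    also have "\<dots> \<le> ((cmod c)\<^sup>2 + 1) * ?q"
      using form.nonneg[OF D] by (simp add: distrib_right)
    also have "\<dots> < ((cmod c)\<^sup>2 + 1) * (e / ((cmod c)\<^sup>2 + 1))"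
      using N that by (intro mult_strict_left_mono) (auto intro: add_nonneg_pos)
    also have "\<dots> = e" using add_nonneg_pos[of "(cmod c)\<^sup>2" 1] by simp
    finally show ?thesis .
  qed
  then show "\<exists>N. \<forall>m\<ge>N. \<forall>n\<ge>N. (c *\<^sub>C u m - c *\<^sub>C u n) \<bullet> op_app S (c *\<^sub>C u m - c *\<^sub>C u n) < e" by blast
qed

lemma linear_friedrichs: "linear_op (friedrichs_ext S)"
  unfolding linear_op_iff
proof (intro conjI allI impI)
  show "single_valued (friedrichs_ext S)"
    by (rule single_valued_subset[OF _ linear_op_single_valued[OF linear_adj]])
       (auto simp: friedrichs_ext_def)
  have "form_Cauchy (\<lambda>_. 0)"
    using subspace_0[OF form.subspace] form.square_add_scale[of 0 0 0] by (simp add: form_Cauchy_def)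
  then have "0 \<in> form_closure_domain S" unfolding form_closure_domain_iff by blast
  then show "(0, 0) \<in> friedrichs_ext S"
    using linear_op_zero[OF linear_adj] by (simp add: friedrichs_ext_def)
next
  fix f g f' g' assume *: "(f, g) \<in> friedrichs_ext S" "(f', g') \<in> friedrichs_ext S"
  then obtain u v where "form_Cauchy u" "u \<longlonglongrightarrow> f" "form_Cauchy v" "v \<longlonglongrightarrow> f'"
    by (auto simp: friedrichs_ext_def form_closure_domain_iff)
  then have "f + f' \<in> form_closure_domain S"
    unfolding form_closure_domain_iff by (blast intro: form_Cauchy_add tendsto_add)
  then show "(f + f', g + g') \<in> friedrichs_ext S"
    using * linear_op_add[OF linear_adj] by (simp add: friedrichs_ext_def)
next
  fix c f g assume *: "(f, g) \<in> friedrichs_ext S"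
  then obtain u where "form_Cauchy u" "u \<longlonglongrightarrow> f"
    by (auto simp: friedrichs_ext_def form_closure_domain_iff)
  then have "c *\<^sub>C f \<in> form_closure_domain S"
    unfolding form_closure_domain_iff by (blast intro: form_Cauchy_scaleC tendsto_scaleC)
  then show "(c *\<^sub>C f, c *\<^sub>C g) \<in> friedrichs_ext S"
    using * linear_op_scaleC[OF linear_adj] by (simp add: friedrichs_ext_def)
qed

text \<open>Form values along a form-Cauchy sequence are bounded, and Cauchy-Schwarz for the form
  passes to the limit. This is the Ando-Nishio condition for membership in the domain of the Krein
  root.\<close>

lemma form_closure_bounded:
  assumes "f \<in> form_closure_domain S"
  shows "\<exists>c\<ge>0. \<forall>w k. (w, k) \<in> S \<longrightarrow> (f \<bullet> k)\<^sup>2 \<le> c * (w \<bullet> k)"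
proof -
  obtain u where u: "form_Cauchy u" "u \<longlonglongrightarrow> f" using assms by (auto simp: form_closure_domain_iff)
  note D = form_Cauchy_Domain[OF u(1)]
  have "\<exists>N. \<forall>m\<ge>N. \<forall>n\<ge>N. (u m - u n) \<bullet> op_app S (u m - u n) < 1"
    using u(1) zero_less_one unfolding form_Cauchy_def by blast
  then obtain N where N: "\<And>m. m \<ge> N \<Longrightarrow> (u m - u N) \<bullet> op_app S (u m - u N) < 1" by blast
  \<comment> \<open>From \<open>form_add_le\<close> applied to
    \<open>u n = (u n - u N) + u N\<close>, where the first summand has form less than 1.\<close>
  define c where "c = 2 + 2 * (u N \<bullet> op_app S (u N))"
  have c: "u n \<bullet> op_app S (u n) \<le> c" if "n \<ge> N" for n
    using form_add_le[OF form.mem(3)[OF D D] D, of n N N] N[OF that] by (simp add: c_def)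
  have "0 \<le> c" using form.nonneg[OF D, of N] by (simp add: c_def)
  moreover have "(f \<bullet> k)\<^sup>2 \<le> c * (w \<bullet> k)" if "(w, k) \<in> S" for w k
  proof (rule LIMSEQ_le_const2)
    show "(\<lambda>n. (u n \<bullet> k)\<^sup>2) \<longlonglongrightarrow> (f \<bullet> k)\<^sup>2" by (intro tendsto_intros u)
    have w: "w \<in> Domain S" "op_app S w = k" using that linear_op_app[OF linear] by auto
    have "(u n \<bullet> k)\<^sup>2 \<le> c * (w \<bullet> k)" if "n \<ge> N" for n
    proof -
      have "(u n \<bullet> k)\<^sup>2 \<le> (u n \<bullet> op_app S (u n)) * (w \<bullet> k)"
        using form.Cauchy_Schwarz[OF D w(1)] by (simp add: w)
      also have "\<dots> \<le> c * (w \<bullet> k)"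
        using form.nonneg[OF w(1)] by (intro mult_right_mono c that) (simp add: w)
      finally show ?thesis .
    qed
    then show "\<exists>N. \<forall>n\<ge>N. (u n \<bullet> k)\<^sup>2 \<le> c * (w \<bullet> k)" by blast
  qed
  ultimately show ?thesis by blast
qed

text \<open>Strict positivity bounds the functional \<open>inner h\<close> by the form, with
  constant \<open>(h \<bullet> h) / \<epsilon>\<close>. The limit of the representing sequence lies
  in the form domain by construction, and the adjoint sends it to \<open>h\<close>.\<close>

lemma friedrichs_surj: "\<exists>f. (f, h) \<in> friedrichs_ext S"
proof -
  obtain \<epsilon> where "0 < \<epsilon>" and \<epsilon>: "\<And>f g. (f, g) \<in> S \<Longrightarrow> \<epsilon> * (norm f)\<^sup>2 \<le> f \<bullet> g" using lower_bound by blast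
  have "\<exists>u. (\<forall>n::nat. u n \<in> Domain S) \<and>
    (\<forall>e>0. \<exists>N. \<forall>m\<ge>N. \<forall>n\<ge>N. (u m - u n) \<bullet> op_app S (u m - u n) < e) \<and>
    (\<forall>g\<in>Domain S. (\<lambda>n. u n \<bullet> op_app S g) \<longlonglongrightarrow> h \<bullet> g)"
  proof (rule form.Riesz_sequence[where C = "(h \<bullet> h) / \<epsilon>"])
    fix f assume "f \<in> Domain S"
    have "(h \<bullet> f)\<^sup>2 \<le> (h \<bullet> h) * (norm f)\<^sup>2"
      using Cauchy_Schwarz_ineq[of h f] by (simp add: power2_norm_eq_inner)
    also have "\<dots> = (h \<bullet> h) / \<epsilon> * (\<epsilon> * (norm f)\<^sup>2)" using \<open>0 < \<epsilon>\<close> by simp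
    also have "\<dots> \<le> (h \<bullet> h) / \<epsilon> * (f \<bullet> op_app S f)"
      using \<open>0 < \<epsilon>\<close> by (intro mult_left_mono \<epsilon> linear_op_mem[OF linear \<open>f \<in> Domain S\<close>]) simp
    finally show "(h \<bullet> f)\<^sup>2 \<le> (h \<bullet> h) / \<epsilon> * (f \<bullet> op_app S f)" .
  qed (use \<open>0 < \<epsilon>\<close> in \<open>simp_all add: inner_add_right\<close>)
  then obtain u where u: "form_Cauchy u"
    and lim: "\<And>g. g \<in> Domain S \<Longrightarrow> (\<lambda>n. u n \<bullet> op_app S g) \<longlonglongrightarrow> h \<bullet> g"
    unfolding form_Cauchy_def by blast
  obtain f where f: "u \<longlonglongrightarrow> f"
    using form_Cauchy_imp_Cauchy[OF u] Cauchy_convergent_iff convergent_def by blast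
  have "f \<bullet> k = h \<bullet> g" if "(g, k) \<in> S" for g k
  proof (rule LIMSEQ_unique)
    show "(\<lambda>n. u n \<bullet> k) \<longlonglongrightarrow> f \<bullet> k" by (intro tendsto_intros f)
    show "(\<lambda>n. u n \<bullet> k) \<longlonglongrightarrow> h \<bullet> g" using lim[of g] that linear_op_app[OF linear that] by auto
  qed
  then have "(f, h) \<in> friedrichs_ext S"
    using u f by (auto simp: friedrichs_ext_def op_adj_iff[OF linear] form_closure_domain_iff)
  then show ?thesis by blast
qed

text \<open>Since \<open>f\<close> is orthogonal to the range of \<open>S\<close>, the pairing of
  \<open>u n - f\<close> with the image of \<open>u n\<close> is the full form of
  \<open>u n\<close>. Form-Cauchyness bounds its square by \<open>e\<close> times the same form
  value, so the form of \<open>u n\<close> is eventually at most \<open>e\<close>.\<close>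

lemma friedrichs_inj:
  assumes "(f, 0) \<in> friedrichs_ext S"
  shows "f = 0"
proof -
  obtain u where u: "form_Cauchy u" "u \<longlonglongrightarrow> f"
    using assms by (auto simp: friedrichs_ext_def form_closure_domain_iff)
  note D = form_Cauchy_Domain[OF u(1)]
  have orth: "f \<bullet> k = 0" if "(w, k) \<in> S" for w k
    using assms that by (simp add: friedrichs_ext_def op_adj_iff[OF linear])
  obtain \<epsilon> where "0 < \<epsilon>" and \<epsilon>: "\<And>f g. (f, g) \<in> S \<Longrightarrow> \<epsilon> * (norm f)\<^sup>2 \<le> f \<bullet> g" using lower_bound by blast
  have "\<epsilon> * (norm f)\<^sup>2 \<le> 0 + e" if "0 < e" for e
  proof -
    obtain N where N: "\<forall>m\<ge>N. \<forall>n\<ge>N. (u m - u n) \<bullet> op_app S (u m - u n) < e"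
      using u(1) \<open>0 < e\<close> unfolding form_Cauchy_def by blast
    have "\<epsilon> * (norm (u n))\<^sup>2 \<le> e" if "n \<ge> N" for n
    proof -
      let ?q = "u n \<bullet> op_app S (u n)"
      have "((u n - f) \<bullet> op_app S (u n))\<^sup>2 \<le> e * ?q"
      proof (rule LIMSEQ_le_const2)
        show "(\<lambda>m. ((u n - u m) \<bullet> op_app S (u n))\<^sup>2) \<longlonglongrightarrow> ((u n - f) \<bullet> op_app S (u n))\<^sup>2"
          by (intro tendsto_intros u)
        have "((u n - u m) \<bullet> op_app S (u n))\<^sup>2 \<le> e * ?q" if "m \<ge> N" for m
        proof -
          have "((u n - u m) \<bullet> op_app S (u n))\<^sup>2 \<le> ((u n - u m) \<bullet> op_app S (u n - u m)) * ?q"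
            by (intro form.Cauchy_Schwarz form.mem D)
          also have "\<dots> \<le> e * ?q"
            using N \<open>n \<ge> N\<close> that by (intro mult_right_mono form.nonneg D less_imp_le) blast
          finally show ?thesis .
        qed
        then show "\<exists>N. \<forall>m\<ge>N. ((u n - u m) \<bullet> op_app S (u n))\<^sup>2 \<le> e * ?q" by blast
      qed
      then have "?q * ?q \<le> e * ?q"
        using orth[OF linear_op_mem[OF linear D], of n] by (simp add: inner_diff_left power2_eq_square)
      then have "?q \<le> e" using form.nonneg[OF D, of n] \<open>0 < e\<close>
        by (cases "?q = 0") (auto simp: mult_le_cancel_right)
      then show ?thesis using \<epsilon>[OF linear_op_mem[OF linear D], of n] by linarith
    qed
    moreover have "(\<lambda>n. \<epsilon> * (norm (u n))\<^sup>2) \<longlonglongrightarrow> \<epsilon> * (norm f)\<^sup>2" by (intro tendsto_intros u)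
    ultimately show ?thesis using LIMSEQ_le_const2 by force
  qed
  then have "\<epsilon> * (norm f)\<^sup>2 \<le> 0" by (rule field_le_epsilon)
  then show ?thesis using \<open>0 < \<epsilon>\<close> by (simp add: mult_le_0_iff)
qed

end

section \<open>The Krein--von Neumann extension\<close>

context strictly_positive_operator
begin

lemma closure_subset_op_adj: "closure S \<subseteq> op_adj S"
  by (rule closure_minimal[OF subset_op_adj closed_op_adj[OF linear]])

lemma closure_linear:
  shows closure_zero: "(0, 0) \<in> closure S"
    and closure_add: "(f, g) \<in> closure S \<Longrightarrow> (f', g') \<in> closure S \<Longrightarrow> (f + f', g + g') \<in> closure S"
    and closure_diff: "(f, g) \<in> closure S \<Longrightarrow> (f', g') \<in> closure S \<Longrightarrow> (f - f', g - g') \<in> closure S"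
    and closure_scaleR: "(f, g) \<in> closure S \<Longrightarrow> (r *\<^sub>R f, r *\<^sub>R g) \<in> closure S"
proof -
  have "subspace S"
    unfolding subspace_def
    using linear_op_zero[OF linear] linear_op_add[OF linear] linear_op_scaleR[OF linear]
    by (auto simp: zero_prod_def)
  then have sub: "subspace (closure S)" by (rule subspace_closure)
  show "(0, 0) \<in> closure S" using subspace_0[OF sub] by (simp add: zero_prod_def)
  show "(f + f', g + g') \<in> closure S" if "(f, g) \<in> closure S" "(f', g') \<in> closure S"
    using subspace_add[OF sub that] by simp
  show "(f - f', g - g') \<in> closure S" if "(f, g) \<in> closure S" "(f', g') \<in> closure S"
    using subspace_diff[OF sub that] by simp
  show "(r *\<^sub>R f, r *\<^sub>R g) \<in> closure S" if "(f, g) \<in> closure S"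
    using subspace_scale[OF sub that, of r] by simp
qed

lemma closure_scaleC:
  assumes "(f, g) \<in> closure S"
  shows "(c *\<^sub>C f, c *\<^sub>C g) \<in> closure S"
proof -
  obtain p where p: "\<forall>n. p n \<in> S" "p \<longlonglongrightarrow> (f, g)" using assms unfolding closure_sequential by blast
  let ?p = "\<lambda>n. (c *\<^sub>C fst (p n), c *\<^sub>C snd (p n))"
  have "\<forall>n. ?p n \<in> S" using p(1) linear_op_scaleC[OF linear] by simp
  moreover have "?p \<longlonglongrightarrow> (c *\<^sub>C f, c *\<^sub>C g)"
    using tendsto_fst[OF p(2)] tendsto_snd[OF p(2)] by (intro tendsto_Pair tendsto_scaleC) simp_all
  ultimately show ?thesis unfolding closure_sequential by (intro exI[of _ ?p]) auto
qed

lemma closure_symmetric: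
  assumes fg: "(f, g) \<in> closure S" and fg': "(f', g') \<in> closure S"
  shows "f \<bullet> g' = g \<bullet> f'"
proof -
  have "closed {p. f \<bullet> snd p = g \<bullet> fst p}" by (intro closed_Collect_eq continuous_intros)
  moreover have "S \<subseteq> {p. f \<bullet> snd p = g \<bullet> fst p}"
    using fg closure_subset_op_adj op_adj_iff[OF linear] by auto
  ultimately have "closure S \<subseteq> {p. f \<bullet> snd p = g \<bullet> fst p}" by (rule closure_minimal[rotated])
  with fg' show ?thesis by auto
qed

lemma closure_lower_bound: "\<exists>\<epsilon>>0. \<forall>f g. (f, g) \<in> closure S \<longrightarrow> \<epsilon> * (norm f)\<^sup>2 \<le> f \<bullet> g"
proof -
  obtain \<epsilon> where "0 < \<epsilon>" and \<epsilon>: "\<And>f g. (f, g) \<in> S \<Longrightarrow> \<epsilon> * (norm f)\<^sup>2 \<le> f \<bullet> g" using lower_bound by blast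
  have "closed {p. \<epsilon> * (norm (fst p))\<^sup>2 \<le> fst p \<bullet> snd p}"
    by (intro closed_Collect_le continuous_intros)
  moreover have "S \<subseteq> {p. \<epsilon> * (norm (fst p))\<^sup>2 \<le> fst p \<bullet> snd p}" using \<epsilon> by auto
  ultimately have "closure S \<subseteq> {p. \<epsilon> * (norm (fst p))\<^sup>2 \<le> fst p \<bullet> snd p}" by (rule closure_minimal[rotated])
  then show ?thesis using \<open>0 < \<epsilon>\<close> by (intro exI[of _ \<epsilon>]) auto
qed

lemma closure_norm_bound: "\<exists>C>0. \<forall>f g. (f, g) \<in> closure S \<longrightarrow> norm f \<le> C * norm g"
proof -
  obtain \<epsilon> where "0 < \<epsilon>" and \<epsilon>: "\<And>f g. (f, g) \<in> closure S \<Longrightarrow> \<epsilon> * (norm f)\<^sup>2 \<le> f \<bullet> g"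
    using closure_lower_bound by blast
  have "norm f \<le> 1 / \<epsilon> * norm g" if "(f, g) \<in> closure S" for f g
  proof -
    have "norm f * (\<epsilon> * norm f) \<le> norm f * norm g"
      using \<epsilon>[OF that] norm_cauchy_schwarz[of f g] by (simp add: power2_eq_square mult_ac)
    then have "\<epsilon> * norm f \<le> norm g" by (cases "f = 0") auto
    then show ?thesis using \<open>0 < \<epsilon>\<close> by (simp add: field_simps)
  qed
  then show ?thesis using \<open>0 < \<epsilon>\<close> by (intro exI[of _ "1 / \<epsilon>"]) simp
qed

lemma closure_single_valued: "(0, g) \<in> closure S \<Longrightarrow> g = 0"
  using closure_subset_op_adj closure_zero linear_op_single_valued[OF linear_adj]
  by (auto dest: single_valuedD)

lemma closure_inj:
  assumes "(f, 0) \<in> closure S"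
  shows "f = 0"
  using closure_norm_bound assms by fastforce

text \<open>The inverse of \<open>closure S\<close> is bounded, so convergence of the images makes
  the arguments Cauchy; the graph is closed.\<close>

lemma closed_Range_closure: "closed (Range (closure S))"
  unfolding closed_sequential_limits
proof (intro allI impI)
  fix g y assume *: "(\<forall>n. g n \<in> Range (closure S)) \<and> g \<longlonglongrightarrow> y"
  then have "\<forall>n. \<exists>f. (f, g n) \<in> closure S" by blast
  then obtain f where f: "\<And>n. (f n, g n) \<in> closure S" by metis
  obtain C where "0 < C" and C: "\<And>f g. (f, g) \<in> closure S \<Longrightarrow> norm f \<le> C * norm g"
    using closure_norm_bound by blast
  have "Cauchy f"
  proof (rule CauchyI)
    fix e :: real assume "0 < e"
    then have "0 < e / C" using \<open>0 < C\<close> by simp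
    moreover have "Cauchy g" using * LIMSEQ_imp_Cauchy by blast
    ultimately obtain N where N: "\<forall>m\<ge>N. \<forall>n\<ge>N. norm (g m - g n) < e / C" using CauchyD by blast
    have "norm (f m - f n) < e" if "m \<ge> N" "n \<ge> N" for m n
    proof -
      have "norm (f m - f n) \<le> C * norm (g m - g n)" by (rule C[OF closure_diff[OF f f]])
      also have "\<dots> < C * (e / C)" using N that \<open>0 < C\<close> by (intro mult_strict_left_mono) auto
      finally show ?thesis using \<open>0 < C\<close> by simp
    qed
    then show "\<exists>M. \<forall>m\<ge>M. \<forall>n\<ge>M. norm (f m - f n) < e" by blast
  qed
  then obtain x where "f \<longlonglongrightarrow> x" using Cauchy_convergent_iff convergent_def by blast
  then have "(\<lambda>n. (f n, g n)) \<longlonglongrightarrow> (x, y)" using * by (intro tendsto_Pair) auto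
  then have "(x, y) \<in> closure S" by (rule closed_sequentially[OF closed_closure, rotated]) (rule f)
  then show "y \<in> Range (closure S)" by blast
qed

lemma kernel_adj_iff: "v \<in> op_ker (op_adj S) \<longleftrightarrow> (\<forall>f g. (f, g) \<in> closure S \<longrightarrow> v \<bullet> g = 0)"
proof
  assume v: "v \<in> op_ker (op_adj S)"
  have "closed {p. v \<bullet> snd p = 0}" by (intro closed_Collect_eq continuous_intros)
  moreover have "S \<subseteq> {p. v \<bullet> snd p = 0}"
    using v by (auto simp: op_ker_def op_adj_iff[OF linear])
  ultimately have "closure S \<subseteq> {p. v \<bullet> snd p = 0}" by (rule closure_minimal[rotated])
  then show "\<forall>f g. (f, g) \<in> closure S \<longrightarrow> v \<bullet> g = 0" by auto
next
  assume "\<forall>f g. (f, g) \<in> closure S \<longrightarrow> v \<bullet> g = 0"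
  then show "v \<in> op_ker (op_adj S)"
    using closure_subset by (auto simp: op_ker_def op_adj_iff[OF linear] subset_iff)
qed

lemma kernel_adj_linear:
  shows kernel_adj_zero: "0 \<in> op_ker (op_adj S)"
    and kernel_adj_add: "v \<in> op_ker (op_adj S) \<Longrightarrow> w \<in> op_ker (op_adj S) \<Longrightarrow> v + w \<in> op_ker (op_adj S)"
    and kernel_adj_diff: "v \<in> op_ker (op_adj S) \<Longrightarrow> w \<in> op_ker (op_adj S) \<Longrightarrow> v - w \<in> op_ker (op_adj S)"
    and kernel_adj_scaleC: "v \<in> op_ker (op_adj S) \<Longrightarrow> c *\<^sub>C v \<in> op_ker (op_adj S)"
proof -
  show "c *\<^sub>C v \<in> op_ker (op_adj S)" if "v \<in> op_ker (op_adj S)"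
    using linear_op_scaleC[OF linear_adj, of v 0 c] that by (simp add: op_ker_def)
qed (auto simp: kernel_adj_iff inner_add_left inner_diff_left)

text \<open>By \<open>kernel_adj_iff\<close> the kernel of the adjoint is the orthogonal complement
  of the closed range of \<open>closure S\<close>.\<close>

lemma orthogonal_decomposition:
  obtains f g where "(f, g) \<in> closure S" "h - g \<in> op_ker (op_adj S)"
proof -
  have "subspace (Range (closure S))"
  proof (rule subspaceI)
    show "0 \<in> Range (closure S)" using closure_zero by blast
    show "x + y \<in> Range (closure S)" if "x \<in> Range (closure S)" "y \<in> Range (closure S)" for x y
      using that closure_add by blast
    show "c *\<^sub>R x \<in> Range (closure S)" if "x \<in> Range (closure S)" for c x
      using that closure_scaleR by blast
  qed
  then obtain g where "g \<in> Range (closure S)" "\<And>z. z \<in> Range (closure S) \<Longrightarrow> (h - g) \<bullet> z = 0"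
    using orthogonal_projection_exists closed_Range_closure by metis
  then show ?thesis using that kernel_adj_iff by blast
qed

lemma decomposition_unique:
  assumes "(f, g) \<in> closure S" "(f', g') \<in> closure S" "g - g' \<in> op_ker (op_adj S)"
  shows "g = g'" "f = f'"
proof -
  have d: "(f - f', g - g') \<in> closure S" using assms closure_diff by blast
  then have "(g - g') \<bullet> (g - g') = 0" using assms(3) kernel_adj_iff by blast
  then show "g = g'" by simp
  with d closure_inj[of "f - f'"] show "f = f'" by simp
qed

text \<open>
  On the range of \<open>closure S\<close>, the orthogonal complement of the kernel of the adjoint, the Krein
  extension inverts the bounded operator \<open>P o (closure S)\<^sup>-\<^sup>1\<close>, where \<open>P\<close> is the orthogonal
  projection onto this range.
\<close>

lemma krein_pseudoinverse: "\<exists>M. bounded_nonneg_op M \<and> krein_ext S = pseudoinverse M"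
proof -
  let ?K = "op_ker (op_adj S)"
  \<comment> \<open>Here \<open>g\<close> is the projection of \<open>h\<close> to the range,
    \<open>f\<close> its preimage under \<open>closure S\<close>, and \<open>m\<close> the
    projection of \<open>f\<close> to the range.\<close>
  have "\<exists>m. \<exists>f g. (f, g) \<in> closure S \<and> h - g \<in> ?K \<and> m \<in> Range (closure S) \<and> f - m \<in> ?K" for h
  proof -
    obtain f g where 1: "(f, g) \<in> closure S" "h - g \<in> ?K" by (rule orthogonal_decomposition)
    obtain m' m where "(m', m) \<in> closure S" "f - m \<in> ?K" by (rule orthogonal_decomposition)
    with 1 show ?thesis by blast
  qed
  then obtain M where M: "\<And>h. \<exists>f g. (f, g) \<in> closure S \<and> h - g \<in> ?K \<and> M h \<in> Range (closure S) \<and> f - M h \<in> ?K"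
    by metis
  have M_rep: "M h \<in> Range (closure S) \<and> f - M h \<in> ?K" if "(f, g) \<in> closure S" "h - g \<in> ?K" for f g h
  proof -
    obtain f' g' where 1: "(f', g') \<in> closure S" "h - g' \<in> ?K" "M h \<in> Range (closure S)" "f' - M h \<in> ?K"
      using M by blast
    have "g - g' \<in> ?K" using kernel_adj_diff[OF 1(2) that(2)] by simp
    then have "f = f'" using decomposition_unique that(1) 1(1) by blast
    with 1 show ?thesis by simp
  qed
  have M_eq: "M h = m" if "(f, g) \<in> closure S" "h - g \<in> ?K" "m \<in> Range (closure S)" "f - m \<in> ?K" for f g h m
  proof -
    have 1: "M h \<in> Range (closure S)" "f - M h \<in> ?K" using M_rep[OF that(1,2)] by auto
    have "M h - m \<in> ?K" using kernel_adj_diff[OF that(4) 1(2)] by simp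
    then show ?thesis using decomposition_unique(1) that(3) 1(1) by blast
  qed
  \<comment> \<open>Both kernel components drop out of the pairing, which reduces symmetry and
    nonnegativity of \<open>M\<close> to those of \<open>closure S\<close>.\<close>
  have M_inner: "M h \<bullet> k = f \<bullet> g'"
    if "(f, g) \<in> closure S" "h - g \<in> ?K" "(f', g') \<in> closure S" "k - g' \<in> ?K" for f g h f' g' k
  proof -
    from M_rep[OF that(1,2)]
    obtain m' where m': "(m', M h) \<in> closure S" and fm: "f - M h \<in> ?K" by blast
    have "(k - g') \<bullet> M h = 0" using that(4) m' kernel_adj_iff by blast
    moreover have "(f - M h) \<bullet> g' = 0" using fm that(3) kernel_adj_iff by blast
    ultimately show ?thesis
      using inner_commute[of k "M h"] inner_commute[of g' "M h"] by (simp add: inner_diff_left)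
  qed
  have "bounded_nonneg_op M"
  proof
    show "M (x + y) = M x + M y" for x y
    proof -
      obtain f g where 1: "(f, g) \<in> closure S" "x - g \<in> ?K" by (rule orthogonal_decomposition)
      obtain f' g' where 2: "(f', g') \<in> closure S" "y - g' \<in> ?K" by (rule orthogonal_decomposition)
      note r1 = M_rep[OF 1] and r2 = M_rep[OF 2]
      show ?thesis
      proof (rule M_eq[OF closure_add[OF 1(1) 2(1)]])
        show "x + y - (g + g') \<in> ?K" using kernel_adj_add[OF 1(2) 2(2)] by (simp add: algebra_simps)
        show "M x + M y \<in> Range (closure S)" using r1 r2 closure_add by blast
        show "f + f' - (M x + M y) \<in> ?K"
          using kernel_adj_add[of "f - M x" "f' - M y"] r1 r2 by (simp add: algebra_simps)
      qed
    qed
    show "M (c *\<^sub>C x) = c *\<^sub>C M x" for c x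
    proof -
      obtain f g where 1: "(f, g) \<in> closure S" "x - g \<in> ?K" by (rule orthogonal_decomposition)
      note r1 = M_rep[OF 1]
      show ?thesis
      proof (rule M_eq[OF closure_scaleC[OF 1(1)]])
        show "c *\<^sub>C x - c *\<^sub>C g \<in> ?K"
          using kernel_adj_scaleC[OF 1(2)] by (simp add: complex_vector.scale_right_diff_distrib)
        show "c *\<^sub>C M x \<in> Range (closure S)" using r1 closure_scaleC by blast
        show "c *\<^sub>C f - c *\<^sub>C M x \<in> ?K"
          using kernel_adj_scaleC[of "f - M x"] r1 by (simp add: complex_vector.scale_right_diff_distrib)
      qed
    qed
    show "M x \<bullet> y = x \<bullet> M y" for x y
    proof -
      obtain f g where 1: "(f, g) \<in> closure S" "x - g \<in> ?K" by (rule orthogonal_decomposition)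
      obtain f' g' where 2: "(f', g') \<in> closure S" "y - g' \<in> ?K" by (rule orthogonal_decomposition)
      show ?thesis
        using M_inner[OF 1 2] M_inner[OF 2 1] closure_symmetric[OF 1(1) 2(1)] by (simp add: inner_commute)
    qed
    show "0 \<le> x \<bullet> M x" for x
    proof -
      obtain f g where 1: "(f, g) \<in> closure S" "x - g \<in> ?K" by (rule orthogonal_decomposition)
      obtain \<epsilon> where "0 < \<epsilon>" "\<epsilon> * (norm f)\<^sup>2 \<le> f \<bullet> g" using closure_lower_bound 1(1) by blast
      moreover have "0 \<le> \<epsilon> * (norm f)\<^sup>2" using \<open>0 < \<epsilon>\<close> by simp
      ultimately have "0 \<le> f \<bullet> g" by linarith
      then show ?thesis using M_inner[OF 1 1] by (simp add: inner_commute)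
    qed
    obtain C where "0 < C" and C: "\<And>f g. (f, g) \<in> closure S \<Longrightarrow> norm f \<le> C * norm g"
      using closure_norm_bound by blast
    have "norm (M x) \<le> norm x * C" for x
    proof -
      obtain f g where 1: "(f, g) \<in> closure S" "x - g \<in> ?K" by (rule orthogonal_decomposition)
      obtain m' where m': "(m', M x) \<in> closure S" and fm: "f - M x \<in> ?K" using M_rep[OF 1] by blast
      have "(f - M x) \<bullet> M x = 0" using fm m' kernel_adj_iff by blast
      then have "norm (M x) * norm (M x) \<le> norm f * norm (M x)"
        using norm_cauchy_schwarz[of f "M x"] by (simp add: inner_diff_left norm_eq_sqrt_inner)
      then have "norm (M x) \<le> norm f" by (cases "M x = 0") auto
      also have "\<dots> \<le> C * norm g" by (rule C[OF 1(1)])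
      also have "norm g \<le> norm x"
      proof -
        have "(x - g) \<bullet> g = 0" using 1 kernel_adj_iff by blast
        then have "norm g * norm g \<le> norm x * norm g"
          using norm_cauchy_schwarz[of x g] by (simp add: inner_diff_left norm_eq_sqrt_inner)
        then show ?thesis by (cases "g = 0") auto
      qed
      finally show ?thesis using \<open>0 < C\<close> by (simp add: mult.commute)
    qed
    then show "\<exists>C. \<forall>x. norm (M x) \<le> norm x * C" by blast
  qed
  have M_kernel: "M h = 0 \<longleftrightarrow> h \<in> ?K" for h
  proof
    assume "M h = 0"
    obtain f g where 1: "(f, g) \<in> closure S" "h - g \<in> ?K" by (rule orthogonal_decomposition)
    obtain \<epsilon> where "0 < \<epsilon>" "\<epsilon> * (norm f)\<^sup>2 \<le> f \<bullet> g" using closure_lower_bound 1(1) by blast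
    moreover have "f \<bullet> g = 0" using M_inner[OF 1 1] \<open>M h = 0\<close> by simp
    ultimately have "f = 0" by (simp add: mult_le_0_iff)
    then have "g = 0" using closure_single_valued 1(1) by blast
    with 1(2) show "h \<in> ?K" by simp
  next
    assume "h \<in> ?K"
    then show "M h = 0"
      using closure_zero kernel_adj_zero by (intro M_eq[of 0 0]) auto
  qed
  have "(x, g) \<in> krein_ext S \<longleftrightarrow> (x, g) \<in> pseudoinverse M" for x g
  proof
    assume "(x, g) \<in> krein_ext S"
    then obtain f g' v where xg: "(x, g) \<in> op_adj S" and fg: "(f, g') \<in> closure S" and v: "v \<in> ?K" "x = f + v"
      unfolding krein_ext_def by blast
    have "(x, g') \<in> op_adj S"
      using linear_op_add[OF linear_adj, of f g' v 0] fg closure_subset_op_adj v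
      by (auto simp: op_ker_def)
    then have "g' = g" using xg linear_op_single_valued[OF linear_adj] by (auto dest: single_valuedD)
    then have "(f, g) \<in> closure S" using fg by simp
    then have "f - M g \<in> ?K" using M_rep kernel_adj_zero by simp
    then have "x - M g \<in> ?K" using kernel_adj_add[OF _ v(1), of "f - M g"] v(2) by (simp add: algebra_simps)
    moreover have "g \<bullet> z = 0" if "z \<in> ?K" for z
      using that \<open>(f, g) \<in> closure S\<close> kernel_adj_iff inner_commute by metis
    ultimately show "(x, g) \<in> pseudoinverse M" by (simp add: pseudoinverse_def M_kernel)
  next
    assume "(x, g) \<in> pseudoinverse M"
    then have x: "x - M g \<in> ?K" and g: "\<And>z. z \<in> ?K \<Longrightarrow> g \<bullet> z = 0"
      by (auto simp: pseudoinverse_def M_kernel)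
    obtain f g' where 1: "(f, g') \<in> closure S" "g - g' \<in> ?K" by (rule orthogonal_decomposition)
    have "(g - g') \<bullet> g' = 0" using 1 kernel_adj_iff by blast
    \<comment> \<open>Orthogonality of \<open>g\<close> to the kernel annihilates its own kernel
      component \<open>g - g'\<close>, so \<open>g\<close> lies in the range.\<close>
    then have "(g - g') \<bullet> (g - g') = 0" using g[OF 1(2)] by (simp add: inner_diff_right inner_commute)
    then have "g' = g" by simp
    then have fg: "(f, g) \<in> closure S" using 1 by simp
    have "f - M g \<in> ?K" using M_rep[OF 1] by simp
    from kernel_adj_diff[OF x this] have xf: "x - f \<in> ?K" by simp
    have "(x, g) \<in> op_adj S"
      using linear_op_add[OF linear_adj, of f g "x - f" 0] fg closure_subset_op_adj xf
      by (auto simp: op_ker_def)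
    moreover have "f \<in> Domain (closure S)" "x = f + (x - f)" using fg by auto
    ultimately show "(x, g) \<in> krein_ext S" unfolding krein_ext_def using xf by blast
  qed
  then have "krein_ext S = pseudoinverse M" by auto
  with \<open>bounded_nonneg_op M\<close> show ?thesis by blast
qed

section \<open>The square root of the Krein extension\<close>

text \<open>The pseudoinverse of a bounded root \<open>N\<close> of \<open>M\<close> is a witness
  for the choice in \<open>op_sqrt\<close>, so the chosen operator has the defining properties
  too.\<close>

lemma op_sqrt_krein:
  shows selfadjoint_sqrt_krein: "selfadjoint (op_sqrt (krein_ext S))"
    and sqrt_krein_square: "op_sqrt (krein_ext S) O op_sqrt (krein_ext S) = krein_ext S"
proof -
  obtain M where M: "bounded_nonneg_op M" "krein_ext S = pseudoinverse M"
    using krein_pseudoinverse by blast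
  then obtain N where N: "bounded_nonneg_op N" "\<And>x. N (N x) = M x"
    using bounded_nonneg_op.sqrt_exists by metis
  then interpret N: bounded_nonneg_op N by blast
  have "selfadjoint (pseudoinverse N) \<and> nonnegative (pseudoinverse N) \<and>
      pseudoinverse N O pseudoinverse N = krein_ext S"
    using N.selfadjoint_pseudoinverse N.nonnegative_pseudoinverse N.pseudoinverse_square
    by (simp add: M N)
  then have "selfadjoint (op_sqrt (krein_ext S)) \<and> nonnegative (op_sqrt (krein_ext S)) \<and>
      op_sqrt (krein_ext S) O op_sqrt (krein_ext S) = krein_ext S"
    unfolding op_sqrt_def by (rule someI)
  then show "selfadjoint (op_sqrt (krein_ext S))"
    "op_sqrt (krein_ext S) O op_sqrt (krein_ext S) = krein_ext S" by blast+
qed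

lemma subset_krein: "S \<subseteq> krein_ext S"
proof (rule subrelI)
  fix f g assume fg: "(f, g) \<in> S"
  then have "(f, g) \<in> op_adj S" "f \<in> Domain (closure S)"
    using subset_op_adj closure_subset by blast+
  then show "(f, g) \<in> krein_ext S"
    unfolding krein_ext_def using kernel_adj_zero by force
qed

text \<open>
  The Ando--Nishio description of the square root of the Krein extension. For the converse, the
  resolvents \<open>(1 + t B\<^sup>2)\<^sup>-\<^sup>1 x\<close> of the square root \<open>B\<close> converge to \<open>x\<close> with bounded images under \<open>B\<close>.
\<close>

lemma sqrt_krein_bound_iff:
  assumes "0 \<le> c"
  shows "(\<exists>y. (x, y) \<in> op_sqrt (krein_ext S) \<and> y \<bullet> y \<le> c) \<longleftrightarrow>
    (\<forall>f k. (f, k) \<in> S \<longrightarrow> (x \<bullet> k)\<^sup>2 \<le> c * (f \<bullet> k))"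
proof -
  define B where "B = op_sqrt (krein_ext S)"
  have sa: "selfadjoint B" unfolding B_def by (rule selfadjoint_sqrt_krein)
  have square: "B O B = krein_ext S" unfolding B_def by (rule sqrt_krein_square)
  have sym: "f \<bullet> k = g \<bullet> h" if "(f, g) \<in> B" "(h, k) \<in> B" for f g h k
    using selfadjoint_iff_graph[OF sa, THEN iffD1, OF that(1)] that(2) by blast
  have "(x \<bullet> k)\<^sup>2 \<le> c * (f \<bullet> k)" if "(x, y) \<in> B" "y \<bullet> y \<le> c" "(f, k) \<in> S" for y f k
  proof -
    have "(f, k) \<in> B O B" using that(3) subset_krein square by blast
    then obtain b where b: "(f, b) \<in> B" "(b, k) \<in> B" by blast
    have "(x \<bullet> k)\<^sup>2 = (y \<bullet> b)\<^sup>2" using sym[OF that(1) b(2)] by simp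
    also have "\<dots> \<le> (y \<bullet> y) * (b \<bullet> b)" by (rule Cauchy_Schwarz_ineq)
    also have "\<dots> \<le> c * (b \<bullet> b)" by (rule mult_right_mono[OF that(2)]) simp
    also have "b \<bullet> b = f \<bullet> k" using sym[OF b] by simp
    finally show ?thesis .
  qed
  moreover have "\<exists>y. (x, y) \<in> B \<and> y \<bullet> y \<le> c"
    if bound: "\<forall>f k. (f, k) \<in> S \<longrightarrow> (x \<bullet> k)\<^sup>2 \<le> c * (f \<bullet> k)"
  proof -
    have "closed {p. (x \<bullet> snd p)\<^sup>2 \<le> c * (fst p \<bullet> snd p)}"
      by (intro closed_Collect_le continuous_intros)
    moreover have "S \<subseteq> {p. (x \<bullet> snd p)\<^sup>2 \<le> c * (fst p \<bullet> snd p)}" using bound by auto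
    ultimately have "closure S \<subseteq> {p. (x \<bullet> snd p)\<^sup>2 \<le> c * (fst p \<bullet> snd p)}"
      by (rule closure_minimal[rotated])
    then have bound_closure: "(x \<bullet> k)\<^sup>2 \<le> c * (f \<bullet> k)" if "(f, k) \<in> closure S" for f k
      using that by auto
    \<comment> \<open>Write \<open>h = f + v\<close> with \<open>v\<close> in the kernel of the
      adjoint. Then \<open>k\<close> is the image of \<open>f\<close> under \<open>closure S\<close>
      and is orthogonal to \<open>v\<close>, so the square of the norm of \<open>b\<close> is
      \<open>f \<bullet> k\<close>.\<close>
    have bound_B: "(x \<bullet> k)\<^sup>2 \<le> c * (b \<bullet> b)" if hb: "(h, b) \<in> B" and bk: "(b, k) \<in> B" for h b k
    proof -
      have hk: "(h, k) \<in> krein_ext S" using hb bk square by blast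
      then obtain f k' v where fk: "(f, k') \<in> closure S" and v: "v \<in> op_ker (op_adj S)" "h = f + v"
        and adj: "(h, k) \<in> op_adj S"
        unfolding krein_ext_def by blast
      have "(h, k') \<in> op_adj S"
        using linear_op_add[OF linear_adj, of f k' v 0] fk closure_subset_op_adj v
        by (auto simp: op_ker_def)
      then have "k' = k" using adj linear_op_single_valued[OF linear_adj] by (auto dest: single_valuedD)
      then have fk: "(f, k) \<in> closure S" using fk by simp
      then have "v \<bullet> k = 0" using v kernel_adj_iff by blast
      then have "b \<bullet> b = f \<bullet> k" using sym[OF hb bk] v(2) by (simp add: inner_add_left)
      with bound_closure[OF fk] show ?thesis by simp
    qed
    have approx: "\<exists>f g. (f, g) \<in> B \<and> g \<bullet> g \<le> c \<and> (norm (x - f))\<^sup>2 \<le> t * c" if "0 < t" for t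
    proof -
      obtain f g k where fg: "(f, g) \<in> B" and gk: "(g, k) \<in> B" and x: "x = f + t *\<^sub>R k"
        using selfadjoint_resolvent_square[OF sa \<open>0 < t\<close>] by metis
      \<comment> \<open>Pairing \<open>x = f + t *\<^sub>R k\<close> with \<open>k\<close> gives
        \<open>a + b\<close>, and \<open>bound_B\<close> gives \<open>(a + b)^2 <= c * a\<close>,
        hence \<open>a + b <= c\<close>. Then \<open>a\<close> controls the image of
        \<open>f\<close>, and \<open>t * b\<close> is the squared distance of \<open>f\<close> from
        \<open>x\<close>.\<close>
      define a where "a = g \<bullet> g"
      define b where "b = t * (k \<bullet> k)"
      have nonneg: "0 \<le> a" "0 \<le> b" using \<open>0 < t\<close> by (simp_all add: a_def b_def)
      have "x \<bullet> k = a + b" using sym[OF fg gk] by (simp add: x a_def b_def inner_add_left)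
      then have "(a + b)\<^sup>2 \<le> c * a" using bound_B[OF fg gk] by (simp add: a_def)
      also have "\<dots> \<le> c * (a + b)" using nonneg \<open>0 \<le> c\<close> by (intro mult_left_mono) auto
      finally have "(a + b) * (a + b) \<le> c * (a + b)" by (simp add: power2_eq_square)
      then have "a + b \<le> c" using nonneg \<open>0 \<le> c\<close> by (cases "a + b = 0") auto
      then have "a \<le> c" "b \<le> c" using nonneg by linarith+
      have "(norm (x - f))\<^sup>2 = t * b"
        by (simp add: x b_def power_mult_distrib power2_norm_eq_inner[symmetric] power2_eq_square)
      also have "\<dots> \<le> t * c" using \<open>0 < t\<close> \<open>b \<le> c\<close> by simp
      finally show ?thesis using fg \<open>a \<le> c\<close> by (auto simp: a_def)
    qed
    \<comment> \<open>The bound is extended to all of the domain of \<open>B\<close>: it holds for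
      every approximant \<open>f\<close>, whose image has squared norm at most \<open>c\<close>, and
      survives the limit.\<close>
    have bound_D: "(x \<bullet> k)\<^sup>2 \<le> c * (w \<bullet> w)" if wk: "(w, k) \<in> B" for w k
    proof -
      have "\<forall>n. \<exists>f. (norm (x - f))\<^sup>2 \<le> inverse (real (Suc n)) * c \<and> (f \<bullet> k)\<^sup>2 \<le> c * (w \<bullet> w)"
      proof
        fix n
        obtain f g where fg: "(f, g) \<in> B" "g \<bullet> g \<le> c" "(norm (x - f))\<^sup>2 \<le> inverse (real (Suc n)) * c"
          using approx[of "inverse (real (Suc n))"] by auto
        have "(f \<bullet> k)\<^sup>2 = (g \<bullet> w)\<^sup>2" using sym[OF fg(1) wk] by simp
        also have "\<dots> \<le> (g \<bullet> g) * (w \<bullet> w)" by (rule Cauchy_Schwarz_ineq)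
        also have "\<dots> \<le> c * (w \<bullet> w)" by (rule mult_right_mono[OF fg(2)]) simp
        finally show "\<exists>f. (norm (x - f))\<^sup>2 \<le> inverse (real (Suc n)) * c \<and> (f \<bullet> k)\<^sup>2 \<le> c * (w \<bullet> w)"
          using fg(3) by blast
      qed
      then obtain f where f: "\<And>n. (norm (x - f n))\<^sup>2 \<le> inverse (real (Suc n)) * c"
        "\<And>n. (f n \<bullet> k)\<^sup>2 \<le> c * (w \<bullet> w)" by metis
      have "(\<lambda>n. (norm (x - f n))\<^sup>2) \<longlonglongrightarrow> 0"
      proof (rule real_tendsto_sandwich[where f = "\<lambda>_. 0"])
        show "(\<lambda>n. inverse (real (Suc n)) * c) \<longlonglongrightarrow> 0"
          by (rule tendsto_mult_left_zero[OF LIMSEQ_inverse_real_of_nat])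
        show "\<forall>\<^sub>F n in sequentially. (norm (x - f n))\<^sup>2 \<le> inverse (real (Suc n)) * c"
          using f(1) by simp
      qed auto
      then have "(\<lambda>n. x - f n) \<longlonglongrightarrow> 0" by (simp add: tendsto_norm_zero_iff)
      from tendsto_diff[OF tendsto_const[of x] this] have lim: "f \<longlonglongrightarrow> x" by simp
      show ?thesis
        by (rule LIMSEQ_le_const2[of "\<lambda>n. (f n \<bullet> k)\<^sup>2"]) (intro tendsto_intros lim, use f(2) in blast)
    qed
    have lin: "linear_op B" using sa by (rule selfadjoint_linear)
    interpret nonneg_form "Domain B" inner by (rule nonneg_form_inner[OF subspace_Domain[OF lin]])
    \<comment> \<open>The functional sending \<open>w\<close> to the pairing of \<open>x\<close>
      with its image is norm bounded. By selfadjointness, the vector representing it is the image of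
      \<open>x\<close>.\<close>
    have "\<exists>u. (\<forall>n::nat. u n \<in> Domain B) \<and>
        (\<forall>e>0. \<exists>N. \<forall>m\<ge>N. \<forall>n\<ge>N. (u m - u n) \<bullet> (u m - u n) < e) \<and>
        (\<forall>g\<in>Domain B. (\<lambda>n. u n \<bullet> g) \<longlonglongrightarrow> x \<bullet> op_app B g)"
    proof (rule Riesz_sequence[where C = c])
      show "(x \<bullet> op_app B f)\<^sup>2 \<le> c * (f \<bullet> f)" if "f \<in> Domain B" for f
        by (rule bound_D[OF linear_op_mem[OF lin that]])
    qed (simp_all add: op_app_add[OF lin] op_app_scaleR[OF lin] inner_add_right \<open>0 \<le> c\<close>)
    then obtain u where u: "\<And>n::nat. u n \<in> Domain B"
      and "\<And>e. e > 0 \<Longrightarrow> \<exists>N. \<forall>m\<ge>N. \<forall>n\<ge>N. (u m - u n) \<bullet> (u m - u n) < e"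
      and lim: "\<And>g. g \<in> Domain B \<Longrightarrow> (\<lambda>n. u n \<bullet> g) \<longlonglongrightarrow> x \<bullet> op_app B g" by blast
    then have "Cauchy u" by (intro Cauchy_if_norm_diff_square) (simp add: power2_norm_eq_inner)
    then obtain y where y: "u \<longlonglongrightarrow> y" using Cauchy_convergent_iff convergent_def by blast
    have y_eq: "x \<bullet> k = y \<bullet> w" if "(w, k) \<in> B" for w k
      using LIMSEQ_unique[OF lim tendsto_inner[OF y tendsto_const]] that linear_op_app[OF lin that] by blast
    have "(x, y) \<in> B"
      by (rule selfadjoint_iff_graph[OF sa, THEN iffD2]) (use y_eq in blast)
    \<comment> \<open>Inserting \<open>w = u n\<close> into \<open>bound_D\<close> and letting
      \<open>u n\<close> tend to \<open>y\<close> preserves the constant \<open>c\<close>.\<close>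
    moreover have "(y \<bullet> y)\<^sup>2 \<le> c * (y \<bullet> y)"
    proof (rule LIMSEQ_le)
      show "(\<lambda>n. (y \<bullet> u n)\<^sup>2) \<longlonglongrightarrow> (y \<bullet> y)\<^sup>2" "(\<lambda>n. c * (u n \<bullet> u n)) \<longlonglongrightarrow> c * (y \<bullet> y)"
        by (intro tendsto_intros y)+
      have "(y \<bullet> u n)\<^sup>2 \<le> c * (u n \<bullet> u n)" for n
        using bound_D[OF linear_op_mem[OF lin u]] y_eq[OF linear_op_mem[OF lin u]] by metis
      then show "\<exists>N. \<forall>n\<ge>N. (y \<bullet> u n)\<^sup>2 \<le> c * (u n \<bullet> u n)" by blast
    qed
    then have "y \<bullet> y \<le> c"
      using \<open>0 \<le> c\<close> by (cases "y = 0") (auto simp: power2_eq_square)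
    ultimately show ?thesis by blast
  qed
  ultimately show ?thesis unfolding B_def by blast
qed

end

section \<open>Dissipative extensions\<close>

text \<open>Extending the identity of \<open>U\<close> linearly gives a projection \<open>p\<close>
  onto \<open>U\<close>; its kernel inside \<open>W\<close> is the complement.\<close>

lemma complex_subspace_complement:
  fixes U W :: "'a::complex_vector set"
  assumes U: "complex_vector.subspace U" and W: "complex_vector.subspace W" and "U \<subseteq> W"
  shows "\<exists>V. complex_vector.subspace V \<and> V \<subseteq> W \<and> V \<inter> U = {0} \<and>
    (\<forall>w\<in>W. \<exists>u\<in>U. \<exists>v\<in>V. w = u + v)"
proof -
  have pair: "vector_space_pair (scaleC :: complex \<Rightarrow> 'a \<Rightarrow> 'a) (scaleC :: complex \<Rightarrow> 'a \<Rightarrow> 'a)"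
    by unfold_locales
  obtain p :: "'a \<Rightarrow> 'a" where p: "p ` UNIV \<subseteq> U" "Vector_Spaces.linear scaleC scaleC p"
    "\<forall>u\<in>U. p (id u) = u"
    using vector_space_pair.linear_exists_left_inverse_on[OF pair complex_vector.linear_id U, simplified]
    by auto
  interpret p: Vector_Spaces.linear scaleC scaleC p by (rule p(2))
  let ?V = "{w \<in> W. p w = 0}"
  have "complex_vector.subspace ?V"
    by (rule complex_vector.subspaceI)
       (use W in \<open>auto simp: p.zero p.add p.scale complex_vector.subspace_0
          complex_vector.subspace_add complex_vector.subspace_scale\<close>)
  moreover have "?V \<inter> U = {0}"
    using p(3) U W by (auto simp: p.zero complex_vector.subspace_0)
  moreover have "\<exists>u\<in>U. \<exists>v\<in>?V. w = u + v" if "w \<in> W" for w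
  proof (intro bexI)
    show "w = p w + (w - p w)" by simp
    show pw: "p w \<in> U" using p(1) by blast
    then have "p w \<in> W" using \<open>U \<subseteq> W\<close> by blast
    with pw show "w - p w \<in> ?V"
      using that p(3) by (simp add: p.diff complex_vector.subspace_diff[OF W])
  qed
  ultimately show ?thesis by (intro exI[of _ ?V]) auto
qed

context strictly_positive_operator
begin

text \<open>To be read with \<open>x = L v + v\<close> and \<open>c = v \<bullet> G v\<close>, where
  \<open>G v\<close> is the Friedrichs image of \<open>L v\<close>. Domain membership is part of the
  left side because \<open>op_app\<close> has no meaningful value outside the domain.\<close>

lemma sqrt_krein_form_iff:
  "x \<in> Domain (op_sqrt (krein_ext S)) \<and> c \<ge> 1 / 4 * (norm (op_app (op_sqrt (krein_ext S)) x))\<^sup>2 \<longleftrightarrow>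
    (\<forall>f k. (f, k) \<in> S \<longrightarrow> 0 \<le> f \<bullet> k + x \<bullet> k + c)"
  (is "?sqrt \<longleftrightarrow> ?form")
proof
  let ?B = "op_sqrt (krein_ext S)"
  have lin: "linear_op ?B" by (rule selfadjoint_linear[OF selfadjoint_sqrt_krein])
  {
    assume sqrt: ?sqrt
    have "0 \<le> 1 / 4 * (norm (op_app ?B x))\<^sup>2" by simp
    with sqrt have "0 \<le> c" by linarith
    have "(x, op_app ?B x) \<in> ?B" "op_app ?B x \<bullet> op_app ?B x \<le> 4 * c"
      using sqrt linear_op_mem[OF lin] by (auto simp: power2_norm_eq_inner)
    then have bound: "(x \<bullet> k)\<^sup>2 \<le> 4 * c * (f \<bullet> k)" if "(f, k) \<in> S" for f k
      using sqrt_krein_bound_iff[of "4 * c" x] that \<open>0 \<le> c\<close> by auto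
    show ?form
    proof (intro allI impI)
      fix f k assume fk: "(f, k) \<in> S"
      then have "0 \<le> f \<bullet> k" using form.nonneg[of f] linear_op_app[OF linear fk] by auto
      moreover have "(x \<bullet> k / 2)\<^sup>2 \<le> c * (f \<bullet> k)" using bound[OF fk] by (simp add: power_divide)
      ultimately have "2 * \<bar>x \<bullet> k / 2\<bar> \<le> c + f \<bullet> k"
        using \<open>0 \<le> c\<close> by (intro two_mul_le_add_if_square_le)
      then show "0 \<le> f \<bullet> k + x \<bullet> k + c" by linarith
    qed
  next
    assume pos: ?form
    \<comment> \<open>The condition at \<open>f = 0\<close>.\<close>
    then have "0 \<le> c" using linear_op_zero[OF linear] by fastforce
    have "(x \<bullet> k)\<^sup>2 \<le> 4 * c * (f \<bullet> k)" if fk: "(f, k) \<in> S" for f k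
    proof -
      have "(x \<bullet> k)\<^sup>2 \<le> 4 * (f \<bullet> k) * c"
      proof (rule discriminant_le_if_nonneg)
        show "0 \<le> f \<bullet> k" using form.nonneg[of f] fk linear_op_app[OF linear fk] by auto
        show "0 \<le> f \<bullet> k * t\<^sup>2 + x \<bullet> k * t + c" for t
          using pos linear_op_scaleR[OF linear fk, of t] by (fastforce simp: power2_eq_square mult_ac)
      qed
      then show ?thesis by (simp add: mult_ac)
    qed
    then obtain y where y: "(x, y) \<in> ?B" "y \<bullet> y \<le> 4 * c"
      using sqrt_krein_bound_iff[of "4 * c" x] \<open>0 \<le> c\<close> by auto
    then show ?sqrt using linear_op_app[OF lin y(1)] by (auto simp: power2_norm_eq_inner)
  }
qed

text \<open>This makes membership of \<open>v\<close> and of \<open>L v + v\<close> in the domain of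
  the root equivalent.\<close>

lemma Domain_friedrichs_subset: "Domain (friedrichs_ext S) \<subseteq> Domain (op_sqrt (krein_ext S))"
proof
  fix u assume "u \<in> Domain (friedrichs_ext S)"
  then have "u \<in> form_closure_domain S" by (auto simp: friedrichs_ext_def)
  from form_closure_bounded[OF this] obtain c where "0 \<le> c"
    "\<forall>w k. (w, k) \<in> S \<longrightarrow> (u \<bullet> k)\<^sup>2 \<le> c * (w \<bullet> k)" by blast
  then show "u \<in> Domain (op_sqrt (krein_ext S))" using sqrt_krein_bound_iff by blast
qed

text \<open>The cross term \<open>f \<bullet> h\<close> becomes \<open>u \<bullet> k\<close> because
  \<open>(u, h)\<close> is in the adjoint. This is how \<open>L v + v\<close> enters the
  criterion.\<close>

lemma extension_inner:
  assumes fk: "(f, k) \<in> S" and uh: "(u, h) \<in> friedrichs_ext S"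
  shows "Im (cinner (f + v) (\<i> *\<^sub>C k + \<i> *\<^sub>C h)) = f \<bullet> k + (u + v) \<bullet> k + v \<bullet> h"
proof -
  have "Im (cinner (f + v) (\<i> *\<^sub>C k + \<i> *\<^sub>C h)) = (f + v) \<bullet> (k + h)"
    by (simp add: scaleC_add_right[symmetric] Im_cinner_scaleC_ii)
  moreover have "u \<bullet> k = h \<bullet> f"
    using fk uh by (simp add: friedrichs_ext_def op_adj_iff[OF linear])
  ultimately show ?thesis by (simp add: inner_add_left inner_add_right inner_commute[of f h])
qed

lemma Domain_op_scaleC: "Domain (op_scaleC c S) = Domain S"
  unfolding op_scaleC_def by blast

lemma ext_VL_graph:
  "ext_VL S V L = {(f + v, \<i> *\<^sub>C k + \<i> *\<^sub>C op_app (friedrichs_ext S) (L v)) | f k v. (f, k) \<in> S \<and> v \<in> V}"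
  unfolding ext_VL_def Domain_op_scaleC using linear_op_app[OF linear] by blast

text \<open>Trivial intersection of \<open>V\<close> with \<open>Domain S\<close> makes the action
  well defined, density is inherited from \<open>Domain S\<close>, and the norm bound at
  \<open>v\<close> gives the sign for all \<open>f\<close> at once.\<close>

lemma dissipative_ext_VL:
  assumes V: "complex_vector.subspace V" and disj: "V \<inter> Domain S = {0}"
    and L: "clinear_on V L" "L ` V \<subseteq> Domain (friedrichs_ext S)"
    and dom: "V \<subseteq> Domain (op_sqrt (krein_ext S))"
    and bound: "\<forall>v\<in>V. Re (cinner v (op_app (friedrichs_ext S) (L v)))
          \<ge> 1 / 4 * (norm (op_app (op_sqrt (krein_ext S)) (L v + v)))\<^sup>2"
  shows "dissipative (ext_VL S V L)" "op_scaleC \<i> S \<subseteq> ext_VL S V L"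
proof -
  let ?F = "friedrichs_ext S" and ?B = "op_sqrt (krein_ext S)"
  define G where "G v = op_app ?F (L v)" for v
  have T_eq: "ext_VL S V L = {(f + v, \<i> *\<^sub>C k + \<i> *\<^sub>C G v) | f k v. (f, k) \<in> S \<and> v \<in> V}"
    unfolding G_def by (rule ext_VL_graph)
  have G_graph: "(L v, G v) \<in> ?F" if "v \<in> V" for v
    unfolding G_def using L(2) that by (intro linear_op_mem[OF linear_friedrichs]) blast
  have G_add: "G (v + w) = G v + G w" if "v \<in> V" "w \<in> V" for v w
  proof -
    have "L (v + w) = L v + L w" using L(1) that by (simp add: clinear_on_def)
    then show ?thesis
      using linear_op_app[OF linear_friedrichs linear_op_add[OF linear_friedrichs G_graph G_graph]] that
      by (simp add: G_def)
  qed
  have G_scaleC: "G (c *\<^sub>C v) = c *\<^sub>C G v" if "v \<in> V" for c v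
  proof -
    have "L (c *\<^sub>C v) = c *\<^sub>C L v" using L(1) that by (simp add: clinear_on_def)
    then show ?thesis
      using linear_op_app[OF linear_friedrichs linear_op_scaleC[OF linear_friedrichs G_graph]] that
      by (simp add: G_def)
  qed
  have V0: "0 \<in> V" by (rule complex_vector.subspace_0[OF V])
  have G0: "G 0 = 0" using G_scaleC[OF V0, of 0] by simp
  have incl: "(f, \<i> *\<^sub>C k) \<in> ext_VL S V L" if "(f, k) \<in> S" for f k
    unfolding T_eq using that V0 G0 by force
  then show "op_scaleC \<i> S \<subseteq> ext_VL S V L" unfolding op_scaleC_def by blast
  have lin: "linear_op (ext_VL S V L)"
    unfolding linear_op_iff
  proof (intro conjI allI impI)
    show "single_valued (ext_VL S V L)"
    proof (rule single_valuedI)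
      fix x y z assume "(x, y) \<in> ext_VL S V L" "(x, z) \<in> ext_VL S V L"
      then obtain f k v f' k' v' where 1: "x = f + v" "y = \<i> *\<^sub>C k + \<i> *\<^sub>C G v" "(f, k) \<in> S" "v \<in> V"
        and 2: "x = f' + v'" "z = \<i> *\<^sub>C k' + \<i> *\<^sub>C G v'" "(f', k') \<in> S" "v' \<in> V"
        unfolding T_eq by blast
      have eq: "v - v' = f' - f" using 1(1) 2(1) by (simp add: algebra_simps)
      have "v - v' \<in> V" by (rule complex_vector.subspace_diff[OF V 1(4) 2(4)])
      moreover have "v - v' \<in> Domain S" unfolding eq using linear_op_diff[OF linear 2(3) 1(3)] by blast
      ultimately have "v - v' = 0" using disj by blast
      then have "v = v'" "f = f'" using eq by auto
      moreover from this have "k = k'" using linear_op_app[OF linear 1(3)] linear_op_app[OF linear 2(3)] by simp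
      ultimately show "y = z" using 1(2) 2(2) by simp
    qed
    show "(0, 0) \<in> ext_VL S V L" using incl[OF linear_op_zero[OF linear]] by simp
  next
    fix x y x' y' assume "(x, y) \<in> ext_VL S V L" "(x', y') \<in> ext_VL S V L"
    then obtain f k v f' k' v' where 1: "x = f + v" "y = \<i> *\<^sub>C k + \<i> *\<^sub>C G v" "(f, k) \<in> S" "v \<in> V"
      and 2: "x' = f' + v'" "y' = \<i> *\<^sub>C k' + \<i> *\<^sub>C G v'" "(f', k') \<in> S" "v' \<in> V"
      unfolding T_eq by blast
    have "x + x' = (f + f') + (v + v')" "y + y' = \<i> *\<^sub>C (k + k') + \<i> *\<^sub>C G (v + v')"
      using 1 2 by (simp_all add: G_add scaleC_add_right)
    then show "(x + x', y + y') \<in> ext_VL S V L"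
      unfolding T_eq using linear_op_add[OF linear 1(3) 2(3)] complex_vector.subspace_add[OF V 1(4) 2(4)]
      by blast
  next
    fix c x y assume "(x, y) \<in> ext_VL S V L"
    then obtain f k v where 1: "x = f + v" "y = \<i> *\<^sub>C k + \<i> *\<^sub>C G v" "(f, k) \<in> S" "v \<in> V"
      unfolding T_eq by blast
    have "c *\<^sub>C x = c *\<^sub>C f + c *\<^sub>C v" "c *\<^sub>C y = \<i> *\<^sub>C c *\<^sub>C k + \<i> *\<^sub>C G (c *\<^sub>C v)"
      using 1 by (simp_all add: G_scaleC scaleC_add_right scaleC_scaleC mult.commute)
    then show "(c *\<^sub>C x, c *\<^sub>C y) \<in> ext_VL S V L"
      unfolding T_eq using linear_op_scaleC[OF linear 1(3)] complex_vector.subspace_scale[OF V 1(4)]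
      by blast
  qed
  have "closure (Domain S) \<subseteq> closure (Domain (ext_VL S V L))"
    using incl by (intro closure_mono) blast
  then have "densely_defined (ext_VL S V L)"
    using lin densely_defined by (auto simp: densely_defined_def)
  moreover have "0 \<le> Im (cinner x y)" if "(x, y) \<in> ext_VL S V L" for x y
  proof -
    from that obtain f k v where 1: "x = f + v" "y = \<i> *\<^sub>C k + \<i> *\<^sub>C G v" "(f, k) \<in> S" "v \<in> V"
      unfolding T_eq by blast
    have B: "linear_op ?B" by (rule selfadjoint_linear[OF selfadjoint_sqrt_krein])
    have "L v + v \<in> Domain ?B"
      using 1(4) dom L(2) Domain_friedrichs_subset subspace_add[OF subspace_Domain[OF B]] by blast
    moreover have "v \<bullet> G v \<ge> 1 / 4 * (norm (op_app ?B (L v + v)))\<^sup>2"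
      using bound 1(4) by (simp add: G_def Re_cinner)
    ultimately have "0 \<le> f \<bullet> k + (L v + v) \<bullet> k + v \<bullet> G v"
      using sqrt_krein_form_iff 1(3) by blast
    then show ?thesis
      using extension_inner[OF 1(3) G_graph[OF 1(4)], of v] 1(1,2) by simp
  qed
  ultimately show "dissipative (ext_VL S V L)"
    using linear_op_mem[OF lin] by (simp add: dissipative_def)
qed

text \<open>\<open>V\<close> is any complement of \<open>Domain S\<close> in
  \<open>Domain T\<close>, and \<open>L v\<close> is the preimage under the Friedrichs extension of
  \<open>- \<i> *\<^sub>C op_app T v\<close>, so that the extension formula returns
  \<open>T\<close>.\<close>

lemma dissipative_extension_is_ext_VL:
  assumes T: "dissipative T" and ext: "op_scaleC \<i> S \<subseteq> T"
  shows "\<exists>V L. T = ext_VL S V L \<and> complex_vector.subspace V \<and>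
    V \<subseteq> Domain (op_sqrt (krein_ext S)) \<and> V \<inter> Domain S = {0} \<and> clinear_on V L \<and>
    L ` V \<subseteq> Domain (friedrichs_ext S) \<and>
    (\<forall>v\<in>V. Re (cinner v (op_app (friedrichs_ext S) (L v)))
          \<ge> 1 / 4 * (norm (op_app (op_sqrt (krein_ext S)) (L v + v)))\<^sup>2)"
proof -
  let ?F = "friedrichs_ext S" and ?B = "op_sqrt (krein_ext S)"
  have lin: "linear_op T" using T by (simp add: dissipative_def densely_defined_def)
  have S_T: "(f, \<i> *\<^sub>C k) \<in> T" if "(f, k) \<in> S" for f k
    using ext that by (auto simp: op_scaleC_def)
  have sub: "complex_vector.subspace (Domain S)" "complex_vector.subspace (Domain T)"
    using linear lin by (auto simp: linear_op_def)
  have "Domain S \<subseteq> Domain T" using S_T by blast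
  from complex_subspace_complement[OF sub this]
  obtain V where V: "complex_vector.subspace V" "V \<subseteq> Domain T" "V \<inter> Domain S = {0}"
    and sum: "\<forall>w\<in>Domain T. \<exists>f\<in>Domain S. \<exists>v\<in>V. w = f + v"
    by (elim exE conjE)
  \<comment> \<open>Injectivity of the Friedrichs extension makes \<open>L\<close> linear although
    its values come from the choice function \<open>R\<close>.\<close>
  have F_unique: "u = u'" if "(u, h) \<in> ?F" "(u', h) \<in> ?F" for u u' h
    using friedrichs_inj[of "u - u'"] linear_op_diff[OF linear_friedrichs that] by simp
  define G where "G v = - \<i> *\<^sub>C op_app T v" for v
  have iG: "\<i> *\<^sub>C G v = op_app T v" for v
    by (simp add: G_def scaleC_scaleC scaleC_one)
  obtain R where R: "\<And>h. (R h, h) \<in> ?F" using friedrichs_surj by metis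
  define L where "L v = R (G v)" for v
  have L_graph: "(L v, G v) \<in> ?F" for v unfolding L_def by (rule R)
  have app_L: "op_app ?F (L v) = G v" for v by (rule linear_op_app[OF linear_friedrichs L_graph])
  have T_clinear: "clinear_on (Domain T) (op_app T)" using lin by (simp add: linear_op_def)
  have L_linear: "clinear_on V L"
    unfolding clinear_on_def
  proof (intro conjI ballI allI)
    fix v w assume "v \<in> V" "w \<in> V"
    then have "G (v + w) = G v + G w"
      using V(2) T_clinear unfolding clinear_on_def G_def by (simp add: scaleC_add_right subset_iff)
    then show "L (v + w) = L v + L w"
      using F_unique[OF L_graph] linear_op_add[OF linear_friedrichs L_graph L_graph] by metis
  next
    fix c v assume "v \<in> V"
    then have "G (c *\<^sub>C v) = c *\<^sub>C G v"
      using V(2) T_clinear unfolding clinear_on_def G_def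
      by (simp add: scaleC_scaleC mult.commute subset_iff)
    then show "L (c *\<^sub>C v) = c *\<^sub>C L v"
      using F_unique[OF L_graph] linear_op_scaleC[OF linear_friedrichs L_graph] by metis
  qed
  have T_mem: "(f + v, \<i> *\<^sub>C k + \<i> *\<^sub>C G v) \<in> T" if "(f, k) \<in> S" "v \<in> V" for f k v
    unfolding iG using V(2) that by (intro linear_op_add[OF lin] S_T linear_op_mem[OF lin]) auto
  have T_eq: "T = ext_VL S V L"
    unfolding ext_VL_graph app_L
  proof (intro subset_antisym subrelI)
    fix x y assume xy: "(x, y) \<in> T"
    then obtain f v where fv: "f \<in> Domain S" "v \<in> V" "x = f + v" using sum by blast
    then obtain k where k: "(f, k) \<in> S" by blast
    have "y = \<i> *\<^sub>C k + \<i> *\<^sub>C G v"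
      using T_mem[OF k fv(2)] xy linear_op_single_valued[OF lin] fv(3) by (auto dest: single_valuedD)
    then show "(x, y) \<in> {(f + v, \<i> *\<^sub>C k + \<i> *\<^sub>C G v) | f k v. (f, k) \<in> S \<and> v \<in> V}"
      using k fv by blast
  next
    fix x y assume "(x, y) \<in> {(f + v, \<i> *\<^sub>C k + \<i> *\<^sub>C G v) | f k v. (f, k) \<in> S \<and> v \<in> V}"
    then show "(x, y) \<in> T" using T_mem by blast
  qed
  have sqrt: "L v + v \<in> Domain ?B \<and> v \<bullet> G v \<ge> 1 / 4 * (norm (op_app ?B (L v + v)))\<^sup>2" if "v \<in> V" for v
  proof (rule sqrt_krein_form_iff[THEN iffD2], intro allI impI)
    fix f k assume fk: "(f, k) \<in> S"
    note mem = T_mem[OF fk that]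
    have "0 \<le> Im (cinner (f + v) (op_app T (f + v)))"
      using T mem by (auto simp: dissipative_def)
    then show "0 \<le> f \<bullet> k + (L v + v) \<bullet> k + v \<bullet> G v"
      unfolding linear_op_app[OF lin mem] extension_inner[OF fk L_graph] .
  qed
  have B: "linear_op ?B" by (rule selfadjoint_linear[OF selfadjoint_sqrt_krein])
  have V_dom: "V \<subseteq> Domain ?B"
  proof
    fix v assume "v \<in> V"
    have "L v \<in> Domain ?B" using L_graph Domain_friedrichs_subset by blast
    with sqrt[OF \<open>v \<in> V\<close>] have "L v + v - L v \<in> Domain ?B"
      using subspace_diff[OF subspace_Domain[OF B]] by blast
    then show "v \<in> Domain ?B" by simp
  qed
  have "L ` V \<subseteq> Domain ?F" using L_graph by blast
  moreover have "\<forall>v\<in>V. Re (cinner v (op_app ?F (L v))) \<ge> 1 / 4 * (norm (op_app ?B (L v + v)))\<^sup>2"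
    using sqrt by (simp add: app_L Re_cinner)
  ultimately show ?thesis using T_eq V(1) V_dom V(3) L_linear by (intro exI conjI)
qed

end

theorem theorem4p8:
  fixes S A :: "'a::chilbert_space operator"
  assumes "strictly_positive S"
    and "A = op_scaleC \<i> S"
  shows "{T. dissipative T \<and> A \<subseteq> T} =
    {ext_VL S V L | V L.
       complex_vector.subspace V \<and>
       V \<subseteq> Domain (op_sqrt (krein_ext S)) \<and>
       V \<inter> Domain A = {0} \<and>
       clinear_on V L \<and>
       L ` V \<subseteq> Domain (friedrichs_ext S) \<and>
       (\<forall>v\<in>V. Re (cinner v (op_app (friedrichs_ext S) (L v)))
          \<ge> 1 / 4 * (norm (op_app (op_sqrt (krein_ext S)) (L v + v)))\<^sup>2)}"
proof -
  interpret strictly_positive_operator S by unfold_locales (rule assms(1))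
  have "Domain A = Domain S" unfolding assms(2) by (rule Domain_op_scaleC)
  show ?thesis
  proof (intro subset_antisym subsetI)
    fix T assume "T \<in> {T. dissipative T \<and> A \<subseteq> T}"
    then have "dissipative T" "op_scaleC \<i> S \<subseteq> T" by (simp_all add: assms(2))
    then show "T \<in> {ext_VL S V L | V L.
       complex_vector.subspace V \<and>
       V \<subseteq> Domain (op_sqrt (krein_ext S)) \<and>
       V \<inter> Domain A = {0} \<and>
       clinear_on V L \<and>
       L ` V \<subseteq> Domain (friedrichs_ext S) \<and>
       (\<forall>v\<in>V. Re (cinner v (op_app (friedrichs_ext S) (L v)))
          \<ge> 1 / 4 * (norm (op_app (op_sqrt (krein_ext S)) (L v + v)))\<^sup>2)}"
      unfolding \<open>Domain A = Domain S\<close>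
      by (intro CollectI dissipative_extension_is_ext_VL)
  next
    fix T assume "T \<in> {ext_VL S V L | V L.
       complex_vector.subspace V \<and>
       V \<subseteq> Domain (op_sqrt (krein_ext S)) \<and>
       V \<inter> Domain A = {0} \<and>
       clinear_on V L \<and>
       L ` V \<subseteq> Domain (friedrichs_ext S) \<and>
       (\<forall>v\<in>V. Re (cinner v (op_app (friedrichs_ext S) (L v)))
          \<ge> 1 / 4 * (norm (op_app (op_sqrt (krein_ext S)) (L v + v)))\<^sup>2)}"
    then obtain V L where T: "T = ext_VL S V L"
      and V: "complex_vector.subspace V" "V \<subseteq> Domain (op_sqrt (krein_ext S))" "V \<inter> Domain S = {0}"
      and L: "clinear_on V L" "L ` V \<subseteq> Domain (friedrichs_ext S)"
        "\<forall>v\<in>V. Re (cinner v (op_app (friedrichs_ext S) (L v)))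
          \<ge> 1 / 4 * (norm (op_app (op_sqrt (krein_ext S)) (L v + v)))\<^sup>2"
      unfolding \<open>Domain A = Domain S\<close> by (elim CollectE exE conjE)
    show "T \<in> {T. dissipative T \<and> A \<subseteq> T}"
      unfolding T assms(2)
      using dissipative_ext_VL[OF V(1,3) L(1,2) V(2) L(3)] by simp
  qed
qed

end
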